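(* Let $\Gamma\backslash G$ be a compact nilmanifold and $g$ a left-invariant Riemannian metric on it. There are no left-invariant complex structures $I,J,K$ on $\Gamma\backslash G$ such that $g$ becomes (strictly) locally conformally hyperkähler with respect to them.
   Context: A nilmanifold $\Gamma\backslash G$ is a compact quotient of a simply connected nilpotent Lie group $G$ by a discrete subgroup $\Gamma$. A differential object on $\Gamma\backslash G$ is called left-invariant if it is induced by projection from a left-invariant differential object on $G$. A hyperHermitian manifold $(M,g,I,J,K)$ is a manifold with three complex structures $I,J,K$ satisfying the quaternionic relations and a metric $g$ Hermitian with respect to each of them. It is locally conformally hyperkähler (lchK) if $g$ is locally conformal to a hyperkähler metric (for $I,J,K$). Then there is a closed one-form $\theta$ (the Lee form) such that the fundamental forms satisfy $d\omega_I=\theta\wedge\omega_I$, $d\omega_J=\theta\wedge\omega_J$, $d\omega_K=\theta\wedge\omega_K$. It is called strictly lchK if $\theta$ is not exact, i.e. $g$ is not globally conformal to a hyperkähler metric. *)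

theory Defs
  imports "HOL-Analysis.Analysis" "HOL-Algebra.Coset"
begin

section \<open>Smooth maps between Euclidean spaces\<close>

fun C_k_on :: "nat \<Rightarrow> 'x::euclidean_space set \<Rightarrow> ('x \<Rightarrow> 'y::euclidean_space) \<Rightarrow> bool" where
  "C_k_on 0 S f \<longleftrightarrow> continuous_on S f"
| "C_k_on (Suc k) S f \<longleftrightarrow>
     (\<forall>x\<in>S. f differentiable (at x)) \<and>
     (\<forall>v. C_k_on k S (\<lambda>x. frechet_derivative f (at x) v))"

text \<open>Only used on open sets \<open>S\<close>.\<close>

definition smooth_on :: "'x::euclidean_space set \<Rightarrow> ('x \<Rightarrow> 'y::euclidean_space) \<Rightarrow> bool" where
  "smooth_on S f \<longleftrightarrow> (\<forall>k. C_k_on k S f)"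

section \<open>Smooth manifolds\<close>

text \<open>
  The atlas is any (not necessarily maximal) smooth atlas; the values of a chart outside its
  domain are irrelevant. The model space \<open>'e\<close> fixes the dimension.
\<close>

record ('a, 'e) manifold =
  mtop :: "'a topology"
  atlas :: "('a set \<times> ('a \<Rightarrow> 'e)) set"

definition smooth_manifold :: "('a, 'e::euclidean_space) manifold \<Rightarrow> bool" where
  "smooth_manifold M \<longleftrightarrow>
     Hausdorff_space (mtop M) \<and> second_countable (mtop M) \<and>
     (\<forall>(U, \<phi>) \<in> atlas M.
        openin (mtop M) U \<and> open (\<phi> ` U) \<and>
        homeomorphic_map (subtopology (mtop M) U) (top_of_set (\<phi> ` U)) \<phi>) \<and>
     (\<Union>(U, \<phi>) \<in> atlas M. U) = topspace (mtop M) \<and>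
     (\<forall>(U, \<phi>) \<in> atlas M. \<forall>(V, \<psi>) \<in> atlas M.
        smooth_on (\<phi> ` (U \<inter> V)) (\<psi> \<circ> inv_into U \<phi>))"

definition smooth_map ::
  "('a, 'e::euclidean_space) manifold \<Rightarrow> ('b, 'f::euclidean_space) manifold \<Rightarrow> ('a \<Rightarrow> 'b) \<Rightarrow> bool"
where
  "smooth_map M N F \<longleftrightarrow>
     continuous_map (mtop M) (mtop N) F \<and>
     (\<forall>(U, \<phi>) \<in> atlas M. \<forall>(V, \<psi>) \<in> atlas N.
        smooth_on (\<phi> ` {x \<in> U. F x \<in> V}) (\<psi> \<circ> F \<circ> inv_into U \<phi>))"

definition product_manifold ::
  "('a, 'e) manifold \<Rightarrow> ('b, 'f) manifold \<Rightarrow> ('a \<times> 'b, 'e \<times> 'f) manifold"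
where
  "product_manifold M N =
     \<lparr>mtop = prod_topology (mtop M) (mtop N),
      atlas = {(U \<times> V, map_prod \<phi> \<psi>) | U \<phi> V \<psi>. (U, \<phi>) \<in> atlas M \<and> (V, \<psi>) \<in> atlas N}\<rparr>"

definition smooth_fun :: "('a, 'e::euclidean_space) manifold \<Rightarrow> 'a set \<Rightarrow> ('a \<Rightarrow> real) \<Rightarrow> bool" where
  "smooth_fun M U f \<longleftrightarrow>
     (\<forall>(V, \<phi>) \<in> atlas M. smooth_on (\<phi> ` (U \<inter> V)) (f \<circ> inv_into V \<phi>))"

definition smooth_near :: "('a, 'e::euclidean_space) manifold \<Rightarrow> 'a \<Rightarrow> ('a \<Rightarrow> real) \<Rightarrow> bool" where
  "smooth_near M p f \<longleftrightarrow> (\<exists>U. openin (mtop M) U \<and> p \<in> U \<and> smooth_fun M U f)"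

section \<open>Tangent vectors and vector fields\<close>

text \<open>
  A tangent vector at \<open>p\<close> is a point derivation: it acts on the real functions that are smooth in
  some neighbourhood of \<open>p\<close>, and it is given there by a directional derivative in a chart, i.e.
  by a linear combination of the coordinate derivations. On all other functions it takes the value
  0, so that tangent vectors are equal iff they agree as derivations. The vector space operations
  are pointwise.
\<close>

type_synonym 'a tvec = "('a \<Rightarrow> real) \<Rightarrow> real"

definition coord_derivation ::
  "('a, 'e::euclidean_space) manifold \<Rightarrow> 'a set \<Rightarrow> ('a \<Rightarrow> 'e) \<Rightarrow> 'a \<Rightarrow> 'e \<Rightarrow> 'a tvec"
where
  "coord_derivation M U \<phi> p w =
     (\<lambda>f. if smooth_near M p f
          then frechet_derivative (f \<circ> inv_into U \<phi>) (at (\<phi> p)) w else 0)"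

definition tangent_space :: "('a, 'e::euclidean_space) manifold \<Rightarrow> 'a \<Rightarrow> 'a tvec set" where
  "tangent_space M p = {coord_derivation M U \<phi> p w | U \<phi> w. (U, \<phi>) \<in> atlas M \<and> p \<in> U}"

definition tangent_map ::
  "('b, 'f::euclidean_space) manifold \<Rightarrow> ('a \<Rightarrow> 'b) \<Rightarrow> 'a \<Rightarrow> 'a tvec \<Rightarrow> 'b tvec"
where
  "tangent_map N F p v = (\<lambda>f. if smooth_near N (F p) f then v (f \<circ> F) else 0)"

definition lincomb :: "real \<Rightarrow> 'a tvec \<Rightarrow> real \<Rightarrow> 'a tvec \<Rightarrow> 'a tvec" where
  "lincomb a u b v = (\<lambda>f. a * u f + b * v f)"

text \<open>Vector fields may be defined on any open set \<open>U\<close>; values outside \<open>U\<close> are irrelevant.\<close>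

definition vector_field ::
  "('a, 'e::euclidean_space) manifold \<Rightarrow> 'a set \<Rightarrow> ('a \<Rightarrow> 'a tvec) \<Rightarrow> bool"
where
  "vector_field M U X \<longleftrightarrow>
     (\<forall>p\<in>U. X p \<in> tangent_space M p) \<and>
     (\<forall>V f. openin (mtop M) V \<and> V \<subseteq> U \<and> smooth_fun M V f \<longrightarrow> smooth_fun M V (\<lambda>p. X p f))"

definition bracket ::
  "('a, 'e::euclidean_space) manifold \<Rightarrow> ('a \<Rightarrow> 'a tvec) \<Rightarrow> ('a \<Rightarrow> 'a tvec) \<Rightarrow> 'a \<Rightarrow> 'a tvec"
where
  "bracket M X Y p =
     (\<lambda>f. if smooth_near M p f then X p (\<lambda>q. Y q f) - Y p (\<lambda>q. X q f) else 0)"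

section \<open>Differential forms\<close>

text \<open>
  The exterior derivative is given by the invariant (Koszul) formula, normalised so that
  \<open>d\<theta>(X, Y) = X \<theta>(Y) - Y \<theta>(X) - \<theta>([X, Y])\<close>.
\<close>

definition one_form ::
  "('a, 'e::euclidean_space) manifold \<Rightarrow> 'a set \<Rightarrow> ('a \<Rightarrow> 'a tvec \<Rightarrow> real) \<Rightarrow> bool"
where
  "one_form M U \<theta> \<longleftrightarrow>
     (\<forall>p\<in>U. \<forall>u\<in>tangent_space M p. \<forall>v\<in>tangent_space M p. \<forall>a b.
        \<theta> p (lincomb a u b v) = a * \<theta> p u + b * \<theta> p v) \<and>
     (\<forall>V X. openin (mtop M) V \<and> V \<subseteq> U \<and> vector_field M V X \<longrightarrow>
        smooth_fun M V (\<lambda>p. \<theta> p (X p)))"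

definition ext_d1 ::
  "('a, 'e::euclidean_space) manifold \<Rightarrow> ('a \<Rightarrow> 'a tvec \<Rightarrow> real) \<Rightarrow>
   ('a \<Rightarrow> 'a tvec) \<Rightarrow> ('a \<Rightarrow> 'a tvec) \<Rightarrow> 'a \<Rightarrow> real"
where
  "ext_d1 M \<theta> X Y p =
     X p (\<lambda>q. \<theta> q (Y q)) - Y p (\<lambda>q. \<theta> q (X q)) - \<theta> p (bracket M X Y p)"

definition ext_d2 ::
  "('a, 'e::euclidean_space) manifold \<Rightarrow> ('a \<Rightarrow> 'a tvec \<Rightarrow> 'a tvec \<Rightarrow> real) \<Rightarrow>
   ('a \<Rightarrow> 'a tvec) \<Rightarrow> ('a \<Rightarrow> 'a tvec) \<Rightarrow> ('a \<Rightarrow> 'a tvec) \<Rightarrow> 'a \<Rightarrow> real"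
where
  "ext_d2 M \<omega> X Y Z p =
     X p (\<lambda>q. \<omega> q (Y q) (Z q)) - Y p (\<lambda>q. \<omega> q (X q) (Z q)) + Z p (\<lambda>q. \<omega> q (X q) (Y q))
     - \<omega> p (bracket M X Y p) (Z p) + \<omega> p (bracket M X Z p) (Y p)
     - \<omega> p (bracket M Y Z p) (X p)"

definition wedge12 ::
  "('a \<Rightarrow> 'a tvec \<Rightarrow> real) \<Rightarrow> ('a \<Rightarrow> 'a tvec \<Rightarrow> 'a tvec \<Rightarrow> real) \<Rightarrow>
   'a \<Rightarrow> 'a tvec \<Rightarrow> 'a tvec \<Rightarrow> 'a tvec \<Rightarrow> real"
where
  "wedge12 \<theta> \<omega> p u v w = \<theta> p u * \<omega> p v w - \<theta> p v * \<omega> p u w + \<theta> p w * \<omega> p u v"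

definition closed_one_form ::
  "('a, 'e::euclidean_space) manifold \<Rightarrow> 'a set \<Rightarrow> ('a \<Rightarrow> 'a tvec \<Rightarrow> real) \<Rightarrow> bool"
where
  "closed_one_form M U \<theta> \<longleftrightarrow> one_form M U \<theta> \<and>
     (\<forall>V X Y. openin (mtop M) V \<and> V \<subseteq> U \<and> vector_field M V X \<and> vector_field M V Y \<longrightarrow>
        (\<forall>p\<in>V. ext_d1 M \<theta> X Y p = 0))"

definition exact_one_form ::
  "('a, 'e::euclidean_space) manifold \<Rightarrow> 'a set \<Rightarrow> ('a \<Rightarrow> 'a tvec \<Rightarrow> real) \<Rightarrow> bool"
where
  "exact_one_form M U \<theta> \<longleftrightarrow>
     (\<exists>f. smooth_fun M U f \<and> (\<forall>p\<in>U. \<forall>u\<in>tangent_space M p. \<theta> p u = u f))"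

definition ext_d2_equals ::
  "('a, 'e::euclidean_space) manifold \<Rightarrow> 'a set \<Rightarrow> ('a \<Rightarrow> 'a tvec \<Rightarrow> 'a tvec \<Rightarrow> real) \<Rightarrow>
   ('a \<Rightarrow> 'a tvec \<Rightarrow> 'a tvec \<Rightarrow> 'a tvec \<Rightarrow> real) \<Rightarrow> bool"
where
  "ext_d2_equals M U \<omega> \<tau> \<longleftrightarrow>
     (\<forall>V X Y Z. openin (mtop M) V \<and> V \<subseteq> U \<and>
        vector_field M V X \<and> vector_field M V Y \<and> vector_field M V Z \<longrightarrow>
        (\<forall>p\<in>V. ext_d2 M \<omega> X Y Z p = \<tau> p (X p) (Y p) (Z p)))"

section \<open>Riemannian metrics and complex structures\<close>

definition riemannian_metric ::
  "('a, 'e::euclidean_space) manifold \<Rightarrow> 'a set \<Rightarrow> ('a \<Rightarrow> 'a tvec \<Rightarrow> 'a tvec \<Rightarrow> real) \<Rightarrow> bool"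
where
  "riemannian_metric M U g \<longleftrightarrow>
     (\<forall>p\<in>U. \<forall>u\<in>tangent_space M p. \<forall>v\<in>tangent_space M p.
        g p u v = g p v u \<and>
        (\<forall>w\<in>tangent_space M p. \<forall>a b. g p (lincomb a u b v) w = a * g p u w + b * g p v w) \<and>
        (u \<noteq> (\<lambda>_. 0) \<longrightarrow> g p u u > 0)) \<and>
     (\<forall>V X Y. openin (mtop M) V \<and> V \<subseteq> U \<and> vector_field M V X \<and> vector_field M V Y \<longrightarrow>
        smooth_fun M V (\<lambda>p. g p (X p) (Y p)))"

definition almost_complex_structure ::
  "('a, 'e::euclidean_space) manifold \<Rightarrow> 'a set \<Rightarrow> ('a \<Rightarrow> 'a tvec \<Rightarrow> 'a tvec) \<Rightarrow> bool"
where
  "almost_complex_structure M U A \<longleftrightarrow>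
     (\<forall>p\<in>U. \<forall>u\<in>tangent_space M p.
        A p u \<in> tangent_space M p \<and> A p (A p u) = (\<lambda>f. - u f) \<and>
        (\<forall>v\<in>tangent_space M p. \<forall>a b. A p (lincomb a u b v) = lincomb a (A p u) b (A p v))) \<and>
     (\<forall>V X. openin (mtop M) V \<and> V \<subseteq> U \<and> vector_field M V X \<longrightarrow>
        vector_field M V (\<lambda>p. A p (X p)))"

definition nijenhuis ::
  "('a, 'e::euclidean_space) manifold \<Rightarrow> ('a \<Rightarrow> 'a tvec \<Rightarrow> 'a tvec) \<Rightarrow>
   ('a \<Rightarrow> 'a tvec) \<Rightarrow> ('a \<Rightarrow> 'a tvec) \<Rightarrow> 'a \<Rightarrow> 'a tvec"
where
  "nijenhuis M A X Y p =
     (\<lambda>f. bracket M (\<lambda>q. A q (X q)) (\<lambda>q. A q (Y q)) p f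
          - A p (bracket M (\<lambda>q. A q (X q)) Y p) f
          - A p (bracket M X (\<lambda>q. A q (Y q)) p) f
          - bracket M X Y p f)"

text \<open>A complex structure is an almost complex structure that is integrable.\<close>

definition complex_structure ::
  "('a, 'e::euclidean_space) manifold \<Rightarrow> 'a set \<Rightarrow> ('a \<Rightarrow> 'a tvec \<Rightarrow> 'a tvec) \<Rightarrow> bool"
where
  "complex_structure M U A \<longleftrightarrow> almost_complex_structure M U A \<and>
     (\<forall>V X Y. openin (mtop M) V \<and> V \<subseteq> U \<and> vector_field M V X \<and> vector_field M V Y \<longrightarrow>
        (\<forall>p\<in>V. nijenhuis M A X Y p = (\<lambda>_. 0)))"

definition hermitian_wrt ::
  "('a, 'e::euclidean_space) manifold \<Rightarrow> 'a set \<Rightarrow> ('a \<Rightarrow> 'a tvec \<Rightarrow> 'a tvec \<Rightarrow> real) \<Rightarrow>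
   ('a \<Rightarrow> 'a tvec \<Rightarrow> 'a tvec) \<Rightarrow> bool"
where
  "hermitian_wrt M U g A \<longleftrightarrow>
     (\<forall>p\<in>U. \<forall>u\<in>tangent_space M p. \<forall>v\<in>tangent_space M p. g p (A p u) (A p v) = g p u v)"

definition hyperhermitian ::
  "('a, 'e::euclidean_space) manifold \<Rightarrow> 'a set \<Rightarrow> ('a \<Rightarrow> 'a tvec \<Rightarrow> 'a tvec \<Rightarrow> real) \<Rightarrow>
   ('a \<Rightarrow> 'a tvec \<Rightarrow> 'a tvec) \<Rightarrow> ('a \<Rightarrow> 'a tvec \<Rightarrow> 'a tvec) \<Rightarrow>
   ('a \<Rightarrow> 'a tvec \<Rightarrow> 'a tvec) \<Rightarrow> bool"
where
  "hyperhermitian M U g I J K \<longleftrightarrow>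
     riemannian_metric M U g \<and>
     (\<forall>A\<in>{I, J, K}. complex_structure M U A \<and> hermitian_wrt M U g A) \<and>
     (\<forall>p\<in>U. \<forall>u\<in>tangent_space M p. I p (J p u) = K p u \<and> J p (I p u) = (\<lambda>f. - K p u f))"

definition fundamental_form ::
  "('a \<Rightarrow> 'a tvec \<Rightarrow> 'a tvec \<Rightarrow> real) \<Rightarrow> ('a \<Rightarrow> 'a tvec \<Rightarrow> 'a tvec) \<Rightarrow>
   'a \<Rightarrow> 'a tvec \<Rightarrow> 'a tvec \<Rightarrow> real"
where
  "fundamental_form g A p u v = g p (A p u) v"

text \<open>Hyperkaehler: the metric is Kaehler with respect to each of the three complex structures.\<close>

definition hyperkaehler ::
  "('a, 'e::euclidean_space) manifold \<Rightarrow> 'a set \<Rightarrow> ('a \<Rightarrow> 'a tvec \<Rightarrow> 'a tvec \<Rightarrow> real) \<Rightarrow>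
   ('a \<Rightarrow> 'a tvec \<Rightarrow> 'a tvec) \<Rightarrow> ('a \<Rightarrow> 'a tvec \<Rightarrow> 'a tvec) \<Rightarrow>
   ('a \<Rightarrow> 'a tvec \<Rightarrow> 'a tvec) \<Rightarrow> bool"
where
  "hyperkaehler M U g I J K \<longleftrightarrow>
     hyperhermitian M U g I J K \<and>
     (\<forall>A\<in>{I, J, K}. ext_d2_equals M U (fundamental_form g A) (\<lambda>_ _ _ _. 0))"

definition lchK ::
  "('a, 'e::euclidean_space) manifold \<Rightarrow> ('a \<Rightarrow> 'a tvec \<Rightarrow> 'a tvec \<Rightarrow> real) \<Rightarrow>
   ('a \<Rightarrow> 'a tvec \<Rightarrow> 'a tvec) \<Rightarrow> ('a \<Rightarrow> 'a tvec \<Rightarrow> 'a tvec) \<Rightarrow>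
   ('a \<Rightarrow> 'a tvec \<Rightarrow> 'a tvec) \<Rightarrow> bool"
where
  "lchK M g I J K \<longleftrightarrow>
     hyperhermitian M (topspace (mtop M)) g I J K \<and>
     (\<forall>p\<in>topspace (mtop M). \<exists>U f. openin (mtop M) U \<and> p \<in> U \<and> smooth_fun M U f \<and>
        hyperkaehler M U (\<lambda>q u v. exp (f q) * g q u v) I J K)"

definition Lee_form ::
  "('a, 'e::euclidean_space) manifold \<Rightarrow> ('a \<Rightarrow> 'a tvec \<Rightarrow> 'a tvec \<Rightarrow> real) \<Rightarrow>
   ('a \<Rightarrow> 'a tvec \<Rightarrow> 'a tvec) \<Rightarrow> ('a \<Rightarrow> 'a tvec \<Rightarrow> 'a tvec) \<Rightarrow>
   ('a \<Rightarrow> 'a tvec \<Rightarrow> 'a tvec) \<Rightarrow> ('a \<Rightarrow> 'a tvec \<Rightarrow> real) \<Rightarrow> bool"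
where
  "Lee_form M g I J K \<theta> \<longleftrightarrow>
     closed_one_form M (topspace (mtop M)) \<theta> \<and>
     (\<forall>A\<in>{I, J, K}. ext_d2_equals M (topspace (mtop M))
        (fundamental_form g A) (wedge12 \<theta> (fundamental_form g A)))"

text \<open>
  An lchK structure has a Lee form, and it is unique: \<open>\<theta> \<and> \<omega> = 0\<close> forces \<open>\<theta> = 0\<close> for a
  non-degenerate \<open>\<omega>\<close> in real dimension at least 4. So the existential quantifier below says that
  the Lee form is not exact.
\<close>

definition strictly_lchK ::
  "('a, 'e::euclidean_space) manifold \<Rightarrow> ('a \<Rightarrow> 'a tvec \<Rightarrow> 'a tvec \<Rightarrow> real) \<Rightarrow>
   ('a \<Rightarrow> 'a tvec \<Rightarrow> 'a tvec) \<Rightarrow> ('a \<Rightarrow> 'a tvec \<Rightarrow> 'a tvec) \<Rightarrow>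
   ('a \<Rightarrow> 'a tvec \<Rightarrow> 'a tvec) \<Rightarrow> bool"
where
  "strictly_lchK M g I J K \<longleftrightarrow>
     lchK M g I J K \<and>
     (\<exists>\<theta>. Lee_form M g I J K \<theta> \<and> \<not> exact_one_form M (topspace (mtop M)) \<theta>)"

section \<open>Nilpotent Lie groups and nilmanifolds\<close>

definition lie_group :: "('a, 'm) monoid_scheme \<Rightarrow> ('a, 'e::euclidean_space) manifold \<Rightarrow> bool" where
  "lie_group G M \<longleftrightarrow>
     group G \<and> smooth_manifold M \<and> topspace (mtop M) = carrier G \<and>
     smooth_map (product_manifold M M) M (\<lambda>(x, y). x \<otimes>\<^bsub>G\<^esub> y) \<and>
     smooth_map M M (\<lambda>x. inv\<^bsub>G\<^esub> x)"

abbreviation left_translate ::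
  "('a, 'm) monoid_scheme \<Rightarrow> ('a, 'e::euclidean_space) manifold \<Rightarrow> 'a \<Rightarrow> 'a \<Rightarrow> 'a tvec \<Rightarrow> 'a tvec"
where
  "left_translate G M a p v \<equiv> tangent_map M (\<lambda>x. a \<otimes>\<^bsub>G\<^esub> x) p v"

text \<open>
  The Lie algebra consists of the left-invariant vector fields. They are normalised to vanish off
  the carrier, so that equality of fields is equality on \<open>G\<close>.
\<close>

definition lie_algebra ::
  "('a, 'm) monoid_scheme \<Rightarrow> ('a, 'e::euclidean_space) manifold \<Rightarrow> ('a \<Rightarrow> 'a tvec) set"
where
  "lie_algebra G M =
     {X. vector_field M (carrier G) X \<and>
         (\<forall>a\<in>carrier G. \<forall>p\<in>carrier G. X (a \<otimes>\<^bsub>G\<^esub> p) = left_translate G M a p (X p)) \<and>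
         (\<forall>p. p \<notin> carrier G \<longrightarrow> X p = (\<lambda>_. 0))}"

definition field_span :: "('a \<Rightarrow> 'a tvec) set \<Rightarrow> ('a \<Rightarrow> 'a tvec) set" where
  "field_span S = {(\<lambda>p f. \<Sum>Z\<in>F. c Z * Z p f) | F c. finite F \<and> F \<subseteq> S}"

fun lower_central ::
  "('a, 'm) monoid_scheme \<Rightarrow> ('a, 'e::euclidean_space) manifold \<Rightarrow> nat \<Rightarrow> ('a \<Rightarrow> 'a tvec) set"
where
  "lower_central G M 0 = lie_algebra G M"
| "lower_central G M (Suc k) =
     field_span {bracket M X Y | X Y. X \<in> lie_algebra G M \<and> Y \<in> lower_central G M k}"

text \<open>A (connected) Lie group is nilpotent if its Lie algebra is.\<close>

definition nilpotent_lie_group ::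
  "('a, 'm) monoid_scheme \<Rightarrow> ('a, 'e::euclidean_space) manifold \<Rightarrow> bool"
where
  "nilpotent_lie_group G M \<longleftrightarrow> lie_group G M \<and> (\<exists>k. lower_central G M k \<subseteq> {\<lambda>_ _. 0})"

text \<open>The analogue of \<open>simply_connected\<close> for abstract topologies, with path-connectedness.\<close>

definition simply_connected_space :: "'a topology \<Rightarrow> bool" where
  "simply_connected_space X \<longleftrightarrow>
     path_connected_space X \<and>
     (\<forall>c d. pathin X c \<and> c 0 = c 1 \<and> pathin X d \<and> d 0 = d 1 \<longrightarrow>
        homotopic_with (\<lambda>r. r 0 = r 1) (top_of_set {0..1}) X c d)"

text \<open>
  \<open>\<Gamma>\G\<close> is the set of cosets \<open>\<Gamma>x\<close> with the quotient topology. Its charts are the charts of \<open>G\<close>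
  transported along the local inverses of the projection.
\<close>

definition coset_proj :: "('a, 'm) monoid_scheme \<Rightarrow> 'a set \<Rightarrow> 'a \<Rightarrow> 'a set" where
  "coset_proj G \<Gamma> x = \<Gamma> #>\<^bsub>G\<^esub> x"

definition quotient_manifold ::
  "('a, 'm) monoid_scheme \<Rightarrow> ('a, 'e::euclidean_space) manifold \<Rightarrow> 'a set \<Rightarrow> ('a set, 'e) manifold"
where
  "quotient_manifold G M \<Gamma> =
     \<lparr>mtop = topology (\<lambda>W. W \<subseteq> rcosets\<^bsub>G\<^esub> \<Gamma> \<and> openin (mtop M) {x \<in> carrier G. coset_proj G \<Gamma> x \<in> W}),
      atlas = {(coset_proj G \<Gamma> ` U, \<phi> \<circ> inv_into U (coset_proj G \<Gamma>)) | U V \<phi>.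
                 (V, \<phi>) \<in> atlas M \<and> openin (mtop M) U \<and> U \<subseteq> V \<and> inj_on (coset_proj G \<Gamma>) U}\<rparr>"

definition compact_nilmanifold ::
  "('a, 'm) monoid_scheme \<Rightarrow> ('a, 'e::euclidean_space) manifold \<Rightarrow> 'a set \<Rightarrow> bool"
where
  "compact_nilmanifold G M \<Gamma> \<longleftrightarrow>
     nilpotent_lie_group G M \<and> simply_connected_space (mtop M) \<and>
     subgroup \<Gamma> G \<and> subtopology (mtop M) \<Gamma> = discrete_topology \<Gamma> \<and>
     compact_space (mtop (quotient_manifold G M \<Gamma>))"

section \<open>Left-invariant objects on a nilmanifold\<close>

text \<open>
  An object on \<open>\<Gamma>\G\<close> is left-invariant if it is induced, via the differential of the projection,
  by an object of the same kind on \<open>G\<close> that is invariant under all left translations.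
\<close>

definition left_invariant_metric ::
  "('a, 'm) monoid_scheme \<Rightarrow> ('a, 'e::euclidean_space) manifold \<Rightarrow> 'a set \<Rightarrow>
   ('a set \<Rightarrow> 'a set tvec \<Rightarrow> 'a set tvec \<Rightarrow> real) \<Rightarrow> bool"
where
  "left_invariant_metric G M \<Gamma> g \<longleftrightarrow>
     (let N = quotient_manifold G M \<Gamma>; \<pi> = coset_proj G \<Gamma> in
      riemannian_metric N (topspace (mtop N)) g \<and>
      (\<exists>h. riemannian_metric M (carrier G) h \<and>
        (\<forall>p\<in>carrier G. \<forall>u\<in>tangent_space M p. \<forall>v\<in>tangent_space M p.
          (\<forall>a\<in>carrier G.
             h (a \<otimes>\<^bsub>G\<^esub> p) (left_translate G M a p u) (left_translate G M a p v) = h p u v) \<and>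
          g (\<pi> p) (tangent_map N \<pi> p u) (tangent_map N \<pi> p v) = h p u v)))"

definition left_invariant_complex_structure ::
  "('a, 'm) monoid_scheme \<Rightarrow> ('a, 'e::euclidean_space) manifold \<Rightarrow> 'a set \<Rightarrow>
   ('a set \<Rightarrow> 'a set tvec \<Rightarrow> 'a set tvec) \<Rightarrow> bool"
where
  "left_invariant_complex_structure G M \<Gamma> A \<longleftrightarrow>
     (let N = quotient_manifold G M \<Gamma>; \<pi> = coset_proj G \<Gamma> in
      complex_structure N (topspace (mtop N)) A \<and>
      (\<exists>B. complex_structure M (carrier G) B \<and>
        (\<forall>p\<in>carrier G. \<forall>u\<in>tangent_space M p.
          (\<forall>a\<in>carrier G.
             B (a \<otimes>\<^bsub>G\<^esub> p) (left_translate G M a p u) = left_translate G M a p (B p u)) \<and>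
          A (\<pi> p) (tangent_map N \<pi> p u) = tangent_map N \<pi> p (B p u))))"

end

(*
  Left-invariant fields descend to the quotient, and there the metric and the fundamental forms
  are constant on them. Evaluating d omega_I = theta wedge omega_I on (X, JX, KX) gives
  theta(X) |X|^2, so theta is constant on left-invariant fields as well; being closed, it vanishes
  on brackets. Everything is thus reduced to the nilpotent Lie algebra. If theta is not zero, take
  a nonzero central z with theta(z) = 0 (from the last nonzero term of the lower central series)
  and T with theta(T) = 1. For A = I, J and y in ker theta the equation for d omega_A reads
  <[T,y], A z> = - <y, A z>, and ad T is nilpotent, so A z is orthogonal to ker theta. But I z and
  J z are nonzero and orthogonal to each other, while ker theta has codimension one.
*)
theory Submission
  imports Defs
begin

section \<open>Calculus of smooth maps\<close>

text \<open>What is shown is that the Lee form vanishes identically; non-exactness is contradicted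
  because the constant 0 is then a primitive. The Lee form is an arbitrary closed form on the
  quotient, with no invariance assumed, so its constancy has to come out of a formula whose other
  side involves brackets and the metric alone. The last nonzero term of the lower central series may
  be the whole algebra; then z need not lie in ker theta, but all brackets vanish and the same
  formula gives |T|^2 = 0. Most of the length has another source. Tangent vectors are functionals on
  all real functions, given by a chart near p and by 0 on functions not smooth there, so brackets
  and images under tangent maps have to be exhibited as coordinate derivations again. For brackets
  this rests on the symmetry of second derivatives. Left-invariance of brackets and their descent to
  the quotient are then two cases of one fact about related vector fields, with a left translation
  or the projection as the map.\<close>

lemma frechet_derivative_eq:
  "(f has_derivative f') (at x) \<Longrightarrow> frechet_derivative f (at x) = f'"
  using frechet_derivative_at by fastforce

text \<open>Derivatives are taken in full neighbourhoods (\<open>at x\<close>), so agreement on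
  \<open>S\<close> passes to them only because \<open>S\<close> is open. The same reason puts
  \<open>open S\<close> into most closure lemmas below.\<close>

lemma C_k_on_cong:
  assumes "open S" "\<And>x. x \<in> S \<Longrightarrow> f x = g x" "C_k_on k S f"
  shows "C_k_on k S g"
  using assms(2,3)
proof (induction k arbitrary: f g)
  case 0
  then show ?case by (simp cong: continuous_on_cong)
next
  case (Suc k)
  have hd: "(g has_derivative frechet_derivative f (at x)) (at x)" if "x \<in> S" for x
    using that Suc.prems assms(1)
    by (auto intro: has_derivative_transform_within_open[where s = S and f = f]
        simp: frechet_derivative_works[symmetric])
  have "C_k_on k S (\<lambda>x. frechet_derivative g (at x) v)" for v
    by (rule Suc.IH[where f = "\<lambda>x. frechet_derivative f (at x) v"])
      (use Suc.prems frechet_derivative_eq[OF hd] in auto)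
  then show ?case
    using hd by (auto simp: differentiable_def)
qed

lemma C_k_on_subset:
  "C_k_on k S f \<Longrightarrow> T \<subseteq> S \<Longrightarrow> C_k_on k T f"
proof (induction k arbitrary: f)
  case 0
  then show ?case by (auto intro: continuous_on_subset)
next
  case (Suc k)
  show ?case using Suc.prems Suc.IH by auto
qed

lemma C_k_on_continuous: "C_k_on k S f \<Longrightarrow> continuous_on S f"
  by (cases k) (auto intro!: continuous_at_imp_continuous_on differentiable_imp_continuous_within)

lemma C_k_on_SucD: "C_k_on (Suc k) S f \<Longrightarrow> C_k_on k S f"
proof (induction k arbitrary: f)
  case 0
  then show ?case using C_k_on_continuous C_k_on.simps(1) by blast
next
  case (Suc k)
  show ?case
    unfolding C_k_on.simps(2)[of k] using Suc.IH Suc.prems C_k_on.simps(2)[of "Suc k"] by blast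
qed

text \<open>Full derivatives depend only on germs, so every order can be checked near each point;
  the sets \<open>T\<close> may stick out of \<open>S\<close>.\<close>

lemma C_k_on_local:
  assumes "\<And>x. x \<in> S \<Longrightarrow> \<exists>T. open T \<and> x \<in> T \<and> C_k_on k T f"
  shows "C_k_on k S f"
  using assms
proof (induction k arbitrary: f)
  case 0
  show ?case
    unfolding C_k_on.simps
  proof (rule continuous_at_imp_continuous_on, rule ballI)
    fix x assume "x \<in> S"
    then obtain T where "open T" "x \<in> T" "continuous_on T f"
      using 0 by force
    then show "isCont f x"
      by (simp add: continuous_on_eq_continuous_at)
  qed
next
  case (Suc k)
  show ?case
    unfolding C_k_on.simps
  proof (intro conjI ballI allI)
    fix x assume "x \<in> S"
    then show "f differentiable at x"
      using Suc.prems by fastforce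
  next
    fix v
    show "C_k_on k S (\<lambda>x. frechet_derivative f (at x) v)"
    proof (rule Suc.IH)
      fix x assume "x \<in> S"
      then show "\<exists>T. open T \<and> x \<in> T \<and> C_k_on k T (\<lambda>x. frechet_derivative f (at x) v)"
        using Suc.prems[of x] C_k_on.simps(2) by blast
    qed
  qed
qed

lemma C_k_on_const: "C_k_on k S (\<lambda>x. c)"
  by (induction k arbitrary: c) auto

lemma C_k_on_bounded_linear:
  assumes "bounded_linear h"
  shows "C_k_on k S f \<Longrightarrow> open S \<Longrightarrow> C_k_on k S (\<lambda>x. h (f x))"
proof (induction k arbitrary: f)
  case 0
  then show ?case
    using bounded_linear.continuous_on[OF assms] by simp
next
  case (Suc k)
  have hd: "((\<lambda>x. h (f x)) has_derivative (\<lambda>v. h (frechet_derivative f (at x) v))) (at x)"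
    if "x \<in> S" for x
    by (rule bounded_linear.has_derivative[OF assms])
      (use that Suc.prems in \<open>simp add: frechet_derivative_works[symmetric]\<close>)
  have "C_k_on k S (\<lambda>x. frechet_derivative (\<lambda>x. h (f x)) (at x) v)" for v
    by (rule C_k_on_cong[where f = "\<lambda>x. h (frechet_derivative f (at x) v)"])
      (use Suc frechet_derivative_eq[OF hd] in auto)
  then show ?case
    using hd by (auto simp: differentiable_def)
qed

lemma C_k_on_linear_map:
  assumes "bounded_linear h"
  shows "C_k_on k S h"
proof (cases k)
  case 0
  then show ?thesis
    using assms by (simp add: linear_continuous_on)
next
  case (Suc l)
  then show ?thesis
    using assms frechet_derivative_eq[OF bounded_linear_imp_has_derivative[OF assms]]
    by (auto simp: C_k_on_const intro: bounded_linear_imp_differentiable)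
qed

lemma C_k_on_add:
  "C_k_on k S f \<Longrightarrow> C_k_on k S g \<Longrightarrow> open S \<Longrightarrow> C_k_on k S (\<lambda>x. f x + g x)"
proof (induction k arbitrary: f g)
  case 0
  then show ?case by (auto intro: continuous_intros)
next
  case (Suc k)
  have hd: "((\<lambda>x. f x + g x) has_derivative
      (\<lambda>v. frechet_derivative f (at x) v + frechet_derivative g (at x) v)) (at x)"
    if "x \<in> S" for x
    using that Suc.prems
    by (auto intro!: has_derivative_add simp: frechet_derivative_works[symmetric])
  have "C_k_on k S (\<lambda>x. frechet_derivative (\<lambda>x. f x + g x) (at x) v)" for v
    by (rule C_k_on_cong[where f = "\<lambda>x. frechet_derivative f (at x) v + frechet_derivative g (at x) v"])
      (use Suc frechet_derivative_eq[OF hd] in auto)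
  then show ?case
    using hd by (auto simp: differentiable_def)
qed

lemma C_k_on_sum:
  "finite A \<Longrightarrow> (\<And>i. i \<in> A \<Longrightarrow> C_k_on k S (f i)) \<Longrightarrow> open S \<Longrightarrow> C_k_on k S (\<lambda>x. \<Sum>i\<in>A. f i x)"
  by (induction A rule: finite_induct) (auto intro: C_k_on_const C_k_on_add)

lemma C_k_on_scaleR:
  "C_k_on k S a \<Longrightarrow> C_k_on k S f \<Longrightarrow> open S \<Longrightarrow> C_k_on k S (\<lambda>x. a x *\<^sub>R f x)"
proof (induction k arbitrary: a f)
  case 0
  then show ?case by (auto intro: continuous_intros)
next
  case (Suc k)
  have hd: "((\<lambda>x. a x *\<^sub>R f x) has_derivative
      (\<lambda>v. a x *\<^sub>R frechet_derivative f (at x) v + frechet_derivative a (at x) v *\<^sub>R f x)) (at x)"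
    if "x \<in> S" for x
    using that Suc.prems
    by (auto intro!: has_derivative_scaleR simp: frechet_derivative_works[symmetric])
  have lower: "C_k_on k S a" "C_k_on k S f"
    using Suc.prems C_k_on_SucD by blast+
  have "C_k_on k S (\<lambda>x. frechet_derivative (\<lambda>x. a x *\<^sub>R f x) (at x) v)" for v
    by (rule C_k_on_cong[where
          f = "\<lambda>x. a x *\<^sub>R frechet_derivative f (at x) v + frechet_derivative a (at x) v *\<^sub>R f x"])
      (use Suc lower frechet_derivative_eq[OF hd] in \<open>auto intro!: C_k_on_add\<close>)
  then show ?case
    using hd by (auto simp: differentiable_def)
qed

text \<open>\<open>C_k_on\<close> speaks of derivatives in fixed directions only. The expansion
  turns a direction that moves with the point, as in the chain rule or in the derivative along a
  field, into coefficients times fixed directions.\<close>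

lemma linear_expand_Basis:
  fixes h :: "'x::euclidean_space \<Rightarrow> 'y::real_vector"
  assumes "linear h"
  shows "h v = (\<Sum>b\<in>Basis. (v \<bullet> b) *\<^sub>R h b)"
  by (subst euclidean_representation[of v, symmetric])
    (simp only: linear_sum[OF assms] linear_scale[OF assms])

text \<open>The derivative of the composite is a sum of components of Dg times partial derivatives
  of \<open>f\<close> taken at \<open>g x\<close>. The induction hypothesis covers the latter
  factor, which is why \<open>g\<close> is also needed at the lower order \<open>k\<close>.\<close>

lemma C_k_on_compose:
  "C_k_on k T f \<Longrightarrow> C_k_on k S g \<Longrightarrow> open S \<Longrightarrow> open T \<Longrightarrow> g ` S \<subseteq> T \<Longrightarrow> C_k_on k S (f \<circ> g)"
proof (induction k arbitrary: f g)
  case 0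
  then show ?case
    using continuous_on_compose[of S g f] continuous_on_subset[of T f "g ` S"] by simp
next
  case (Suc k)
  have df: "f differentiable at (g x)" if "x \<in> S" for x
    using that Suc.prems by auto
  have dg: "g differentiable at x" if "x \<in> S" for x
    using that Suc.prems by auto
  have lower: "C_k_on k S g"
    using Suc.prems C_k_on_SucD by blast
  have eq: "frechet_derivative (f \<circ> g) (at x) v =
      (\<Sum>b\<in>Basis. (frechet_derivative g (at x) v \<bullet> b) *\<^sub>R frechet_derivative f (at (g x)) b)"
    if "x \<in> S" for x v
    unfolding frechet_derivative_compose[OF dg[OF that] df[OF that]] comp_apply
    by (rule linear_expand_Basis[OF linear_frechet_derivative[OF df[OF that]]])
  have "C_k_on k S (\<lambda>x. frechet_derivative (f \<circ> g) (at x) v)" for v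
  proof (rule C_k_on_cong[OF \<open>open S\<close> eq[symmetric]])
    show "C_k_on k S (\<lambda>x. \<Sum>b\<in>Basis. (frechet_derivative g (at x) v \<bullet> b) *\<^sub>R
        frechet_derivative f (at (g x)) b)"
    proof (intro C_k_on_sum C_k_on_scaleR)
      fix b :: 'a assume "b \<in> Basis"
      show "C_k_on k S (\<lambda>x. frechet_derivative g (at x) v \<bullet> b)"
        using Suc.prems by (intro C_k_on_bounded_linear[OF bounded_linear_inner_left]) auto
      show "C_k_on k S (\<lambda>x. frechet_derivative f (at (g x)) b)"
        using Suc.IH[of "\<lambda>y. frechet_derivative f (at y) b" g] Suc.prems lower
        by (simp add: comp_def)
    qed (use Suc.prems in auto)
  qed
  then show ?case
    using df dg differentiable_chain_at[of g _ f] by (auto simp: comp_def)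
qed

section \<open>Closure properties of smooth maps, all orders at once\<close>

lemma smooth_on_cong:
  "smooth_on S f \<Longrightarrow> open S \<Longrightarrow> (\<And>x. x \<in> S \<Longrightarrow> f x = g x) \<Longrightarrow> smooth_on S g"
  unfolding smooth_on_def using C_k_on_cong by blast

lemma smooth_on_subset: "smooth_on S f \<Longrightarrow> T \<subseteq> S \<Longrightarrow> smooth_on T f"
  unfolding smooth_on_def using C_k_on_subset by blast

lemma smooth_on_local:
  "(\<And>x. x \<in> S \<Longrightarrow> \<exists>T. open T \<and> x \<in> T \<and> smooth_on T f) \<Longrightarrow> smooth_on S f"
  unfolding smooth_on_def by (meson C_k_on_local)

lemma smooth_on_const: "smooth_on S (\<lambda>x. c)"
  by (simp add: smooth_on_def C_k_on_const)

lemma smooth_on_bounded_linear: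
  "bounded_linear h \<Longrightarrow> smooth_on S f \<Longrightarrow> open S \<Longrightarrow> smooth_on S (\<lambda>x. h (f x))"
  unfolding smooth_on_def using C_k_on_bounded_linear by blast

lemma smooth_on_linear_map: "bounded_linear h \<Longrightarrow> smooth_on S h"
  unfolding smooth_on_def using C_k_on_linear_map by blast

lemma smooth_on_add:
  "smooth_on S f \<Longrightarrow> smooth_on S g \<Longrightarrow> open S \<Longrightarrow> smooth_on S (\<lambda>x. f x + g x)"
  unfolding smooth_on_def using C_k_on_add by blast

lemma smooth_on_compose:
  "smooth_on T f \<Longrightarrow> smooth_on S g \<Longrightarrow> open S \<Longrightarrow> open T \<Longrightarrow> g ` S \<subseteq> T \<Longrightarrow> smooth_on S (f \<circ> g)"
  unfolding smooth_on_def using C_k_on_compose by blast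

lemma smooth_on_differentiable: "smooth_on S f \<Longrightarrow> x \<in> S \<Longrightarrow> f differentiable at x"
  unfolding smooth_on_def by (metis C_k_on.simps(2))

lemma smooth_on_derivative: "smooth_on S f \<Longrightarrow> smooth_on S (\<lambda>x. frechet_derivative f (at x) v)"
  unfolding smooth_on_def by (metis C_k_on.simps(2))

lemma smooth_on_continuous: "smooth_on S f \<Longrightarrow> continuous_on S f"
  unfolding smooth_on_def by (metis C_k_on.simps(1))

lemma smooth_on_sum:
  "finite A \<Longrightarrow> (\<And>i. i \<in> A \<Longrightarrow> smooth_on S (f i)) \<Longrightarrow> open S \<Longrightarrow> smooth_on S (\<lambda>x. \<Sum>i\<in>A. f i x)"
  unfolding smooth_on_def using C_k_on_sum[of A _ S f] by blast

lemma smooth_on_scaleR: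
  "smooth_on S a \<Longrightarrow> smooth_on S f \<Longrightarrow> open S \<Longrightarrow> smooth_on S (\<lambda>x. a x *\<^sub>R f x)"
  unfolding smooth_on_def using C_k_on_scaleR by blast

lemma smooth_on_Pair:
  fixes f :: "'x::euclidean_space \<Rightarrow> 'y::euclidean_space" and g :: "'x \<Rightarrow> 'z::euclidean_space"
  assumes "smooth_on S f" "smooth_on S g" "open S"
  shows "smooth_on S (\<lambda>x. (f x, g x))"
proof -
  have "bounded_linear (\<lambda>y::'y. (y, 0::'z))" "bounded_linear (\<lambda>z::'z. (0::'y, z))"
    by (auto intro!: bounded_linear_Pair bounded_linear_ident bounded_linear_zero)
  from smooth_on_bounded_linear[OF this(1) assms(1,3)] smooth_on_bounded_linear[OF this(2) assms(2,3)]
  show ?thesis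
    using smooth_on_add[of S "\<lambda>x. (f x, 0)" "\<lambda>x. (0, g x)"] assms(3) by simp
qed

text \<open>The second difference over the parallelogram with sides \<open>h *\<^sub>R u\<close> and
  \<open>h *\<^sub>R v\<close> is an increment in direction \<open>u\<close> of a difference in
  direction \<open>v\<close>. The mean value theorem along \<open>u\<close> leaves a difference of
  first derivatives, and a second application along \<open>v\<close> leaves a mixed second
  derivative.\<close>

lemma second_difference_mvt:
  fixes f :: "'x::euclidean_space \<Rightarrow> real"
  assumes f: "smooth_on S f" and h: "0 < h"
    and S: "\<And>s t. 0 \<le> s \<Longrightarrow> s \<le> h \<Longrightarrow> 0 \<le> t \<Longrightarrow> t \<le> h \<Longrightarrow> x + s *\<^sub>R u + t *\<^sub>R v \<in> S"
  shows "\<exists>s t. 0 \<le> s \<and> s \<le> h \<and> 0 \<le> t \<and> t \<le> h \<and>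
     f (x + h *\<^sub>R u + h *\<^sub>R v) - f (x + h *\<^sub>R u) - f (x + h *\<^sub>R v) + f x =
     h * h * frechet_derivative (\<lambda>y. frechet_derivative f (at y) u) (at (x + s *\<^sub>R u + t *\<^sub>R v)) v"
proof -
  have line: "((\<lambda>r. F (c + r *\<^sub>R w)) has_derivative
      (\<lambda>d. d * frechet_derivative F (at (c + r *\<^sub>R w)) w)) (at r)"
    if "F differentiable (at (c + r *\<^sub>R w))" for F :: "'x \<Rightarrow> real" and c w and r :: real
  proof -
    have 1: "((\<lambda>r. c + r *\<^sub>R w) has_derivative (\<lambda>d. d *\<^sub>R w)) (at r)"
      by (auto intro!: derivative_eq_intros)
    have 2: "(F has_derivative frechet_derivative F (at (c + r *\<^sub>R w))) (at (c + r *\<^sub>R w))"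
      using that by (simp add: frechet_derivative_works[symmetric])
    have "linear (frechet_derivative F (at (c + r *\<^sub>R w)))"
      using that linear_frechet_derivative by blast
    then show ?thesis
      using diff_chain_at[OF 1 2] by (simp add: comp_def linear_scale)
  qed
  define D where "D = (\<lambda>y. frechet_derivative f (at y) u)"
  have D: "smooth_on S D"
    unfolding D_def by (rule smooth_on_derivative[OF f])
  define G where "G = (\<lambda>s. f ((x + h *\<^sub>R v) + s *\<^sub>R u) - f (x + s *\<^sub>R u))"
  have dG: "(G has_derivative (\<lambda>d. d * (D ((x + h *\<^sub>R v) + s *\<^sub>R u) - D (x + s *\<^sub>R u)))) (at s)"
    if "0 \<le> s" "s \<le> h" for s
  proof -
    have "(x + h *\<^sub>R v) + s *\<^sub>R u \<in> S" "x + s *\<^sub>R u \<in> S"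
      using S[of s h] S[of s 0] that h by (auto simp: algebra_simps)
    then have "f differentiable at ((x + h *\<^sub>R v) + s *\<^sub>R u)" "f differentiable at (x + s *\<^sub>R u)"
      using smooth_on_differentiable[OF f] by auto
    from has_derivative_diff[OF line[OF this(1)] line[OF this(2)]]
    show ?thesis unfolding G_def D_def by (simp add: right_diff_distrib)
  qed
  obtain s where s: "0 < s" "s < h" "G h - G 0 = h * (D ((x + h *\<^sub>R v) + s *\<^sub>R u) - D (x + s *\<^sub>R u))"
    using mvt_simple[OF h, of G "\<lambda>s d. d * (D ((x + h *\<^sub>R v) + s *\<^sub>R u) - D (x + s *\<^sub>R u))",
        OF has_derivative_at_withinI[OF dG]] by auto
  define H where "H = (\<lambda>t. D ((x + s *\<^sub>R u) + t *\<^sub>R v))"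
  have dH: "(H has_derivative (\<lambda>d. d * frechet_derivative D (at ((x + s *\<^sub>R u) + t *\<^sub>R v)) v)) (at t)"
    if "0 \<le> t" "t \<le> h" for t
    unfolding H_def
    by (rule line, rule smooth_on_differentiable[OF D], rule S) (use s that in auto)
  obtain t where t: "0 < t" "t < h" "H h - H 0 = h * frechet_derivative D (at ((x + s *\<^sub>R u) + t *\<^sub>R v)) v"
    using mvt_simple[OF h, of H "\<lambda>t d. d * frechet_derivative D (at ((x + s *\<^sub>R u) + t *\<^sub>R v)) v",
        OF has_derivative_at_withinI[OF dH]] by auto
  have "G h - G 0 = h * (H h - H 0)"
    using s(3) by (simp add: H_def algebra_simps)
  also have "\<dots> = h * h * frechet_derivative D (at (x + s *\<^sub>R u + t *\<^sub>R v)) v"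
    using t(3) by simp
  finally show ?thesis
    using s t unfolding G_def D_def
    by (intro exI[of _ s] exI[of _ t]) (simp add: algebra_simps)
qed

text \<open>The second difference does not change when \<open>u\<close> and \<open>v\<close> are
  swapped, so the two mixed derivatives share a value at points as close to \<open>x\<close> as
  desired; continuity finishes.\<close>

lemma second_derivative_symmetric:
  fixes f :: "'x::euclidean_space \<Rightarrow> real"
  assumes f: "smooth_on S f" and S: "open S" and x: "x \<in> S"
  shows "frechet_derivative (\<lambda>y. frechet_derivative f (at y) u) (at x) v =
         frechet_derivative (\<lambda>y. frechet_derivative f (at y) v) (at x) u"
proof (rule ccontr)
  define A where "A = (\<lambda>y. frechet_derivative (\<lambda>y. frechet_derivative f (at y) u) (at y) v)"
  define B where "B = (\<lambda>y. frechet_derivative (\<lambda>y. frechet_derivative f (at y) v) (at y) u)"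
  assume "\<not> ?thesis"
  \<comment> \<open>Half the gap is the tolerance: one number cannot be closer than that to both
    \<open>A x\<close> and \<open>B x\<close>.\<close>
  then have ne: "\<bar>A x - B x\<bar> / 2 > 0"
    by (simp add: A_def B_def)
  have "isCont A x" "isCont B x"
    unfolding A_def B_def
    using smooth_on_continuous[OF smooth_on_derivative[OF smooth_on_derivative[OF f]]] S x
    by (auto simp: continuous_on_eq_continuous_at)
  then obtain d1 d2 where d1: "d1 > 0" "\<And>y. dist y x < d1 \<Longrightarrow> dist (A y) (A x) < \<bar>A x - B x\<bar> / 2"
    and d2: "d2 > 0" "\<And>y. dist y x < d2 \<Longrightarrow> dist (B y) (B x) < \<bar>A x - B x\<bar> / 2"
    using ne unfolding continuous_at_eps_delta by metis
  obtain e where e: "e > 0" "ball x e \<subseteq> S"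
    using S x open_contains_ball by blast
  define d where "d = min e (min d1 d2)"
  have "d > 0" using d1 d2 e by (simp add: d_def)
  \<comment> \<open>This keeps the whole parallelogram within \<open>d / 2\<close> of
    \<open>x\<close>; the summand 1 covers \<open>u = v = 0\<close>.\<close>
  define h where "h = d / (2 * (norm u + norm v + 1))"
  have h: "h > 0" unfolding h_def using \<open>d > 0\<close>
    by (intro divide_pos_pos mult_pos_pos) (auto intro: add_nonneg_pos)
  have near: "dist (x + s *\<^sub>R u + t *\<^sub>R v) x < d" if "0 \<le> s" "s \<le> h" "0 \<le> t" "t \<le> h" for s t
  proof -
    have "dist (x + s *\<^sub>R u + t *\<^sub>R v) x = norm (s *\<^sub>R u + t *\<^sub>R v)"
      by (simp add: dist_norm algebra_simps)
    also have "\<dots> \<le> s * norm u + t * norm v"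
      using norm_triangle_ineq[of "s *\<^sub>R u" "t *\<^sub>R v"] that by simp
    also have "\<dots> \<le> h * (norm u + norm v + 1)"
      using that h by (simp add: distrib_left add_mono mult_right_mono add_increasing2)
    also have "\<dots> = d / 2"
    proof -
      have "norm u + norm v + 1 > 0" by (simp add: add_nonneg_pos)
      then show ?thesis by (simp add: h_def field_simps)
    qed
    finally show ?thesis using \<open>d > 0\<close> by simp
  qed
  have inS: "x + s *\<^sub>R u + t *\<^sub>R v \<in> S" "x + s *\<^sub>R v + t *\<^sub>R u \<in> S"
    if "0 \<le> s" "s \<le> h" "0 \<le> t" "t \<le> h" for s t
    using near[of s t] near[of t s] that e(2)
    by (auto simp: d_def dist_commute subset_iff add.commute add.left_commute)
  obtain s t where st: "0 \<le> s" "s \<le> h" "0 \<le> t" "t \<le> h"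
     "f (x + h *\<^sub>R u + h *\<^sub>R v) - f (x + h *\<^sub>R u) - f (x + h *\<^sub>R v) + f x = h * h * A (x + s *\<^sub>R u + t *\<^sub>R v)"
    using second_difference_mvt[OF f h inS(1)] unfolding A_def by blast
  obtain s' t' where st': "0 \<le> s'" "s' \<le> h" "0 \<le> t'" "t' \<le> h"
     "f (x + h *\<^sub>R v + h *\<^sub>R u) - f (x + h *\<^sub>R v) - f (x + h *\<^sub>R u) + f x = h * h * B (x + s' *\<^sub>R v + t' *\<^sub>R u)"
    using second_difference_mvt[OF f h inS(2)] unfolding B_def by blast
  have "x + h *\<^sub>R v + h *\<^sub>R u = x + h *\<^sub>R u + h *\<^sub>R v" by simp
  note st'(5)[unfolded this]
  with st(5) have "h * h * A (x + s *\<^sub>R u + t *\<^sub>R v) = h * h * B (x + s' *\<^sub>R v + t' *\<^sub>R u)"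
    by linarith
  then have AB: "A (x + s *\<^sub>R u + t *\<^sub>R v) = B (x + s' *\<^sub>R v + t' *\<^sub>R u)"
    using h by simp
  have "dist (A (x + s *\<^sub>R u + t *\<^sub>R v)) (A x) < \<bar>A x - B x\<bar> / 2"
    using near[OF st(1-4)] by (intro d1(2)) (simp add: d_def)
  moreover have "dist (B (x + s' *\<^sub>R v + t' *\<^sub>R u)) (B x) < \<bar>A x - B x\<bar> / 2"
    using near[OF st'(3,4,1,2)] by (intro d2(2)) (simp add: d_def algebra_simps)
  moreover have "False" if "\<bar>c - a\<bar> < \<bar>a - b\<bar> / 2" "\<bar>c - b\<bar> < \<bar>a - b\<bar> / 2" for a b c :: real
    using that by (auto simp: abs_if split: if_splits)
  ultimately show False
    unfolding AB dist_real_def by blast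
qed

text \<open>Product rule for a derivative whose direction \<open>\<eta> y\<close> moves with the
  point. Symmetry of second derivatives puts the second-order term into the form with inner
  direction \<open>v\<close> and outer direction \<open>\<eta> x\<close>.\<close>

lemma derivative_along_field:
  fixes f :: "'x::euclidean_space \<Rightarrow> real"
  assumes f: "smooth_on S f" and e: "smooth_on S \<eta>" and S: "open S" and x: "x \<in> S"
  shows "frechet_derivative (\<lambda>y. frechet_derivative f (at y) (\<eta> y)) (at x) v =
     frechet_derivative f (at x) (frechet_derivative \<eta> (at x) v) +
     frechet_derivative (\<lambda>y. frechet_derivative f (at y) v) (at x) (\<eta> x)"
proof -
  let ?D = "\<lambda>b y. frechet_derivative f (at y) b"
  have lin: "linear (frechet_derivative f (at y))" if "y \<in> S" for y
    using smooth_on_differentiable[OF f that] linear_frechet_derivative by blast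
  have exp: "(\<Sum>b\<in>Basis. (\<eta> y \<bullet> b) *\<^sub>R ?D b y) = ?D (\<eta> y) y" if "y \<in> S" for y
    using linear_expand_Basis[OF lin[OF that]] by metis
  have dD: "(?D b has_derivative frechet_derivative (?D b) (at x)) (at x)" for b
    using smooth_on_differentiable[OF smooth_on_derivative[OF f] x]
    by (simp add: frechet_derivative_works[symmetric])
  have de: "(\<eta> has_derivative frechet_derivative \<eta> (at x)) (at x)"
    using smooth_on_differentiable[OF e x] by (simp add: frechet_derivative_works[symmetric])
  have "((\<lambda>y. \<Sum>b\<in>Basis. (\<eta> y \<bullet> b) *\<^sub>R ?D b y) has_derivative
     (\<lambda>v. \<Sum>b\<in>Basis. (\<eta> x \<bullet> b) *\<^sub>R frechet_derivative (?D b) (at x) v +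
        (frechet_derivative \<eta> (at x) v \<bullet> b) *\<^sub>R ?D b x)) (at x)"
    by (intro has_derivative_sum has_derivative_scaleR has_derivative_inner_left de dD)
  then have "((\<lambda>y. ?D (\<eta> y) y) has_derivative
     (\<lambda>v. \<Sum>b\<in>Basis. (\<eta> x \<bullet> b) *\<^sub>R frechet_derivative (?D b) (at x) v +
        (frechet_derivative \<eta> (at x) v \<bullet> b) *\<^sub>R ?D b x)) (at x)"
    by (rule has_derivative_transform_within_open[OF _ S x]) (rule exp)
  then have "frechet_derivative (\<lambda>y. ?D (\<eta> y) y) (at x) v =
     (\<Sum>b\<in>Basis. (\<eta> x \<bullet> b) *\<^sub>R frechet_derivative (?D b) (at x) v) +
     (\<Sum>b\<in>Basis. (frechet_derivative \<eta> (at x) v \<bullet> b) *\<^sub>R ?D b x)"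
    by (simp add: frechet_derivative_eq sum.distrib)
  also have "(\<Sum>b\<in>Basis. (frechet_derivative \<eta> (at x) v \<bullet> b) *\<^sub>R ?D b x) =
      ?D (frechet_derivative \<eta> (at x) v) x"
    using linear_expand_Basis[OF lin[OF x], of "frechet_derivative \<eta> (at x) v"] by metis
  also have "(\<Sum>b\<in>Basis. (\<eta> x \<bullet> b) *\<^sub>R frechet_derivative (?D b) (at x) v) =
      (\<Sum>b\<in>Basis. (\<eta> x \<bullet> b) *\<^sub>R frechet_derivative (?D v) (at x) b)"
    using second_derivative_symmetric[OF f S x] by simp
  also have "\<dots> = frechet_derivative (?D v) (at x) (\<eta> x)"
    using linear_expand_Basis[of "frechet_derivative (?D v) (at x)" "\<eta> x"]
      has_derivative_linear[OF dD] by metis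
  finally show ?thesis by simp
qed

section \<open>Smooth functions and tangent vectors on a manifold\<close>

locale smooth_mfd =
  fixes M :: "('a, 'e::euclidean_space) manifold"
  assumes mfd: "smooth_manifold M"
begin

lemma chart_openin: "(U, \<phi>) \<in> atlas M \<Longrightarrow> openin (mtop M) U"
  using mfd unfolding smooth_manifold_def by blast

lemma chart_homeo:
  "(U, \<phi>) \<in> atlas M \<Longrightarrow> homeomorphic_map (subtopology (mtop M) U) (top_of_set (\<phi> ` U)) \<phi>"
  using mfd unfolding smooth_manifold_def by blast

lemma chart_transition:
  "(U, \<phi>) \<in> atlas M \<Longrightarrow> (V, \<psi>) \<in> atlas M \<Longrightarrow> smooth_on (\<phi> ` (U \<inter> V)) (\<psi> \<circ> inv_into U \<phi>)"
proof -
  assume c: "(U, \<phi>) \<in> atlas M" "(V, \<psi>) \<in> atlas M"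
  have "\<forall>(U, \<phi>) \<in> atlas M. \<forall>(V, \<psi>) \<in> atlas M. smooth_on (\<phi> ` (U \<inter> V)) (\<psi> \<circ> inv_into U \<phi>)"
    using mfd by (simp add: smooth_manifold_def)
  from bspec[OF bspec[OF this c(1), unfolded prod.case] c(2)] show ?thesis
    by simp
qed

lemma chart_subset: "(U, \<phi>) \<in> atlas M \<Longrightarrow> U \<subseteq> topspace (mtop M)"
  using chart_openin openin_subset by blast

lemma chart_inj:
  assumes "(U, \<phi>) \<in> atlas M" shows "inj_on \<phi> U"
  using homeomorphic_imp_injective_map[OF chart_homeo[OF assms]] chart_subset[OF assms]
  by (simp add: Int_absorb1)

lemma chart_inv: "(U, \<phi>) \<in> atlas M \<Longrightarrow> p \<in> U \<Longrightarrow> inv_into U \<phi> (\<phi> p) = p"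
  using chart_inj by simp

lemma chart_open_image:
  assumes c: "(U, \<phi>) \<in> atlas M" and W: "openin (mtop M) W" "W \<subseteq> U"
  shows "open (\<phi> ` W)"
proof -
  have "openin (subtopology (mtop M) U) W"
    using W by (metis Int_absorb1 openin_subtopology_Int2)
  then have "openin (top_of_set (\<phi> ` U)) (\<phi> ` W)"
    using homeomorphic_imp_open_map[OF chart_homeo[OF c]] by (simp add: open_map_def)
  moreover have "open (\<phi> ` U)"
    using mfd c unfolding smooth_manifold_def by blast
  ultimately show ?thesis
    using openin_open_eq by blast
qed

lemma chart_preimage_openin:
  assumes c: "(U, \<phi>) \<in> atlas M" and S: "open S"
  shows "openin (mtop M) {x \<in> U. \<phi> x \<in> S}"
proof -
  have "continuous_map (subtopology (mtop M) U) (top_of_set (\<phi> ` U)) \<phi>"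
    using homeomorphic_imp_continuous_map[OF chart_homeo[OF c]] .
  then have "openin (subtopology (mtop M) U)
      {x \<in> topspace (subtopology (mtop M) U). \<phi> x \<in> \<phi> ` U \<inter> S}"
    using S openin_continuous_map_preimage openin_open_Int by blast
  moreover have "{x \<in> topspace (subtopology (mtop M) U). \<phi> x \<in> \<phi> ` U \<inter> S} = {x \<in> U. \<phi> x \<in> S}"
    using chart_subset[OF c] by auto
  ultimately show ?thesis
    using openin_trans_full[OF _ chart_openin[OF c]] by simp
qed

lemma chart_at:
  assumes "p \<in> topspace (mtop M)"
  obtains U \<phi> where "(U, \<phi>) \<in> atlas M" "p \<in> U"
proof -
  have "(\<Union>(U, \<phi>) \<in> atlas M. U) = topspace (mtop M)"
    using mfd by (simp add: smooth_manifold_def)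
  then have "p \<in> (\<Union>(U, \<phi>) \<in> atlas M. U)"
    using assms by simp
  then show ?thesis
    using that by auto
qed

lemma smooth_fun_chart:
  "smooth_fun M W f \<Longrightarrow> (U, \<phi>) \<in> atlas M \<Longrightarrow> smooth_on (\<phi> ` (W \<inter> U)) (f \<circ> inv_into U \<phi>)"
  unfolding smooth_fun_def by blast

lemma smooth_fun_subset: "smooth_fun M U f \<Longrightarrow> V \<subseteq> U \<Longrightarrow> smooth_fun M V f"
  unfolding smooth_fun_def
  by (force intro: smooth_on_subset)

text \<open>Transition maps are smooth, so one chart around each point is enough although the
  definition asks for all of them.\<close>

lemma smooth_funI:
  assumes U: "openin (mtop M) U"
    and loc: "\<And>p. p \<in> U \<Longrightarrow> \<exists>V \<phi> W. (V, \<phi>) \<in> atlas M \<and> openin (mtop M) W \<and> p \<in> W \<and> W \<subseteq> V \<and>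
      smooth_on (\<phi> ` W) (f \<circ> inv_into V \<phi>)"
  shows "smooth_fun M U f"
  unfolding smooth_fun_def
proof (intro ballI, clarify, rule smooth_on_local)
  fix V' \<psi> y
  assume c': "(V', \<psi>) \<in> atlas M" and "y \<in> \<psi> ` (U \<inter> V')"
  then obtain p where p: "p \<in> U" "p \<in> V'" "y = \<psi> p" by auto
  from loc[OF p(1)] obtain V \<phi> W where c: "(V, \<phi>) \<in> atlas M"
    and W: "openin (mtop M) W" "p \<in> W" "W \<subseteq> V"
    and sm: "smooth_on (\<phi> ` W) (f \<circ> inv_into V \<phi>)" by blast
  define T where "T = \<psi> ` (W \<inter> V')"
  have op: "openin (mtop M) (W \<inter> V')"
    using W(1) chart_openin[OF c'] by blast
  have T: "open T" "y \<in> T"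
    unfolding T_def using chart_open_image[OF c' op] p W(2) by auto
  have tr: "smooth_on T (\<phi> \<circ> inv_into V' \<psi>)"
    unfolding T_def by (rule smooth_on_subset[OF chart_transition[OF c' c]]) (use W in auto)
  have "smooth_on T ((f \<circ> inv_into V \<phi>) \<circ> (\<phi> \<circ> inv_into V' \<psi>))"
    by (rule smooth_on_compose[OF sm tr T(1) chart_open_image[OF c W(1,3)]])
      (auto simp: T_def chart_inv[OF c'])
  then have "smooth_on T (f \<circ> inv_into V' \<psi>)"
    by (rule smooth_on_cong[OF _ T(1)])
      (use W(3) in \<open>auto simp: T_def chart_inv[OF c'] chart_inv[OF c] subset_iff\<close>)
  then show "\<exists>T. open T \<and> y \<in> T \<and> smooth_on T (f \<circ> inv_into V' \<psi>)"
    using T by blast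
qed

lemma smooth_fun_cong:
  assumes "smooth_fun M U f" "openin (mtop M) U" "\<And>x. x \<in> U \<Longrightarrow> f x = g x"
  shows "smooth_fun M U g"
  unfolding smooth_fun_def
proof (intro ballI, clarify)
  fix V \<phi> assume c: "(V, \<phi>) \<in> atlas M"
  show "smooth_on (\<phi> ` (U \<inter> V)) (g \<circ> inv_into V \<phi>)"
    by (rule smooth_on_cong[OF smooth_fun_chart[OF assms(1) c]])
      (use assms(2,3) chart_openin[OF c] in
        \<open>auto intro!: chart_open_image[OF c] simp: chart_inv[OF c]\<close>)
qed

lemma smooth_fun_const: "smooth_fun M U (\<lambda>x. c)"
  unfolding smooth_fun_def by (auto simp: comp_def smooth_on_const)

lemma smooth_fun_lincomb:
  assumes "smooth_fun M U f" "smooth_fun M U g" "openin (mtop M) U"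
  shows "smooth_fun M U (\<lambda>x. a * f x + b * g x)"
  unfolding smooth_fun_def
proof (intro ballI, clarify)
  fix V \<phi> assume c: "(V, \<phi>) \<in> atlas M"
  have o: "open (\<phi> ` (U \<inter> V))"
    using assms(3) chart_openin[OF c] by (intro chart_open_image[OF c]) auto
  have "smooth_on (\<phi> ` (U \<inter> V)) (\<lambda>y. (a *\<^sub>R (f \<circ> inv_into V \<phi>) y + b *\<^sub>R (g \<circ> inv_into V \<phi>) y))"
    by (intro smooth_on_add smooth_on_scaleR smooth_on_const o
        smooth_fun_chart[OF assms(1) c] smooth_fun_chart[OF assms(2) c])
  then show "smooth_on (\<phi> ` (U \<inter> V)) ((\<lambda>x. a * f x + b * g x) \<circ> inv_into V \<phi>)"
    by (simp add: comp_def)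
qed

text \<open>Supplies the coordinate functions \<open>\<lambda>x. \<phi> x \<bullet> b\<close>, the
  test functions from which the components of a vector field are read off.\<close>

lemma smooth_fun_coordinate:
  assumes c: "(U, \<phi>) \<in> atlas M" and h: "bounded_linear h"
  shows "smooth_fun M U (\<lambda>x. h (\<phi> x))"
  unfolding smooth_fun_def
proof (intro ballI, clarify)
  fix V \<psi> assume c': "(V, \<psi>) \<in> atlas M"
  have tr: "smooth_on (\<psi> ` (U \<inter> V)) (\<phi> \<circ> inv_into V \<psi>)"
    using chart_transition[OF c' c] by (simp add: Int_commute)
  have "open (\<psi> ` (U \<inter> V))"
    using chart_openin[OF c] chart_openin[OF c'] by (intro chart_open_image[OF c']) auto
  from smooth_on_bounded_linear[OF h tr this]
  show "smooth_on (\<psi> ` (U \<inter> V)) ((\<lambda>x. h (\<phi> x)) \<circ> inv_into V \<psi>)"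
    by (simp add: comp_def)
qed

lemma smooth_nearI: "openin (mtop M) U \<Longrightarrow> p \<in> U \<Longrightarrow> smooth_fun M U f \<Longrightarrow> smooth_near M p f"
  unfolding smooth_near_def by blast

lemma smooth_near_cong:
  assumes "openin (mtop M) W" "p \<in> W" "\<And>x. x \<in> W \<Longrightarrow> f x = g x" "smooth_near M p f"
  shows "smooth_near M p g"
proof -
  obtain U where U: "openin (mtop M) U" "p \<in> U" "smooth_fun M U f"
    using assms(4) unfolding smooth_near_def by blast
  have "smooth_fun M (U \<inter> W) g"
    by (rule smooth_fun_cong[OF smooth_fun_subset[OF U(3)]]) (use U assms in auto)
  then show ?thesis
    using U assms by (intro smooth_nearI[of "U \<inter> W"]) auto
qed

lemma smooth_near_topspace: "smooth_near M p f \<Longrightarrow> p \<in> topspace (mtop M)"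
  unfolding smooth_near_def using openin_subset by blast

lemma smooth_near_in_chart:
  assumes c: "(U, \<phi>) \<in> atlas M" "p \<in> U" and f: "smooth_near M p f"
  obtains W where "openin (mtop M) W" "p \<in> W" "W \<subseteq> U" "smooth_fun M W f"
    "open (\<phi> ` W)" "smooth_on (\<phi> ` W) (f \<circ> inv_into U \<phi>)"
proof -
  obtain V where V: "openin (mtop M) V" "p \<in> V" "smooth_fun M V f"
    using f unfolding smooth_near_def by blast
  have o: "openin (mtop M) (V \<inter> U)"
    using V(1) chart_openin[OF c(1)] by blast
  show ?thesis
    by (rule that[of "V \<inter> U"])
      (use V c o chart_open_image[OF c(1) o] smooth_fun_chart[OF V(3) c(1)] smooth_fun_subset[OF V(3)] in auto)
qed

lemma smooth_near_differentiable:
  assumes c: "(U, \<phi>) \<in> atlas M" "p \<in> U" and f: "smooth_near M p f"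
  shows "(f \<circ> inv_into U \<phi>) differentiable at (\<phi> p)"
  using smooth_near_in_chart[OF assms] smooth_on_differentiable by (metis imageI)

lemma chart_germ_cong:
  assumes c: "(U, \<phi>) \<in> atlas M" "p \<in> U"
    and W: "openin (mtop M) W" "p \<in> W" "\<And>x. x \<in> W \<Longrightarrow> f x = g x"
    and d: "(f \<circ> inv_into U \<phi>) differentiable at (\<phi> p)"
  shows "frechet_derivative (f \<circ> inv_into U \<phi>) (at (\<phi> p)) =
    frechet_derivative (g \<circ> inv_into U \<phi>) (at (\<phi> p))"
proof (rule frechet_derivative_transform_within_open[OF d])
  show "open (\<phi> ` (W \<inter> U))"
    using W(1) chart_openin[OF c(1)] by (intro chart_open_image[OF c(1)]) auto
qed (use c W in \<open>auto simp: chart_inv[OF c(1)]\<close>)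

section \<open>Tangent spaces as spaces of coordinate derivations\<close>

lemma tangent_spaceE:
  assumes "u \<in> tangent_space M p"
  obtains U \<phi> w where "(U, \<phi>) \<in> atlas M" "p \<in> U" "u = coord_derivation M U \<phi> p w"
  using assms unfolding tangent_space_def by blast

lemma tangent_space_nonsmooth: "u \<in> tangent_space M p \<Longrightarrow> \<not> smooth_near M p f \<Longrightarrow> u f = 0"
  unfolding tangent_space_def coord_derivation_def by auto

text \<open>Both branches of a coordinate derivation, the derivative and the default 0, depend only
  on the germ of the function at \<open>p\<close>.\<close>

lemma tangent_cong:
  assumes u: "u \<in> tangent_space M p"
    and W: "openin (mtop M) W" "p \<in> W" "\<And>x. x \<in> W \<Longrightarrow> f x = g x"
  shows "u f = u g"
proof -
  obtain U \<phi> w where c: "(U, \<phi>) \<in> atlas M" "p \<in> U" and ueq: "u = coord_derivation M U \<phi> p w"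
    using tangent_spaceE[OF u] .
  have "smooth_near M p f \<longleftrightarrow> smooth_near M p g"
    using smooth_near_cong[OF W(1,2), of f g] smooth_near_cong[OF W(1,2), of g f] W(3) by auto
  moreover have "frechet_derivative (f \<circ> inv_into U \<phi>) (at (\<phi> p)) =
      frechet_derivative (g \<circ> inv_into U \<phi>) (at (\<phi> p))" if "smooth_near M p f"
    by (rule chart_germ_cong[OF c W(1,2) _ smooth_near_differentiable[OF c that]]) (rule W(3))
  ultimately show ?thesis
    by (simp add: ueq coord_derivation_def)
qed

lemma tangent_const:
  assumes u: "u \<in> tangent_space M p"
    and W: "openin (mtop M) W" "p \<in> W" "\<And>x. x \<in> W \<Longrightarrow> f x = c"
  shows "u f = 0"
proof -
  have "u f = u (\<lambda>_. c)"
    by (rule tangent_cong[OF u W(1,2)]) (rule W(3))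
  also have "\<dots> = 0"
    by (rule tangent_spaceE[OF u]) (simp add: coord_derivation_def comp_def)
  finally show ?thesis .
qed

lemma coord_derivation_in_tangent_space:
  "(U, \<phi>) \<in> atlas M \<Longrightarrow> p \<in> U \<Longrightarrow> coord_derivation M U \<phi> p w \<in> tangent_space M p"
  unfolding tangent_space_def by blast

text \<open>A vector may come from any chart around \<open>p\<close>; the derivative of the
  transition map gives its components in the prescribed one. Two vectors can thus be added in a
  common chart.\<close>

lemma tangent_in_chart:
  assumes u: "u \<in> tangent_space M p" and c: "(U, \<phi>) \<in> atlas M" "p \<in> U"
  obtains w where "u = coord_derivation M U \<phi> p w"
proof -
  obtain V \<psi> w where c': "(V, \<psi>) \<in> atlas M" "p \<in> V" and ueq: "u = coord_derivation M V \<psi> p w"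
    using tangent_spaceE[OF u] .
  let ?t = "\<phi> \<circ> inv_into V \<psi>"
  have VU: "openin (mtop M) (V \<inter> U)"
    using chart_openin[OF c(1)] chart_openin[OF c'(1)] by blast
  have dt: "?t differentiable at (\<psi> p)"
    by (rule smooth_on_differentiable[OF chart_transition[OF c'(1) c(1)]]) (use c c' in auto)
  have "frechet_derivative (f \<circ> inv_into V \<psi>) (at (\<psi> p)) w =
      frechet_derivative (f \<circ> inv_into U \<phi>) (at (\<phi> p)) (frechet_derivative ?t (at (\<psi> p)) w)"
    if f: "smooth_near M p f" for f
  proof -
    \<comment> \<open>Near \<open>p\<close> the function \<open>f\<close> equals
      \<open>f \<circ> inv_into U \<phi> \<circ> \<phi>\<close>, which makes the transition map
      appear.\<close>
    have "frechet_derivative (f \<circ> inv_into V \<psi>) (at (\<psi> p)) =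
        frechet_derivative ((f \<circ> inv_into U \<phi>) \<circ> ?t) (at (\<psi> p))"
      using chart_germ_cong[OF c' VU, of f "(f \<circ> inv_into U \<phi>) \<circ> \<phi>",
          OF _ _ smooth_near_differentiable[OF c' f]] c c'
      by (auto simp: chart_inv[OF c(1)] comp_assoc)
    also have "\<dots> = frechet_derivative (f \<circ> inv_into U \<phi>) (at (?t (\<psi> p))) \<circ>
        frechet_derivative ?t (at (\<psi> p))"
      by (rule frechet_derivative_compose[OF dt])
        (use smooth_near_differentiable[OF c f] c' in \<open>simp add: chart_inv[OF c'(1)]\<close>)
    finally show ?thesis
      by (simp add: chart_inv[OF c'(1)] c')
  qed
  then have "u = coord_derivation M U \<phi> p (frechet_derivative ?t (at (\<psi> p)) w)"
    by (auto simp: ueq coord_derivation_def)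
  then show ?thesis by (rule that)
qed

lemma lincomb_in_tangent_space:
  assumes "u \<in> tangent_space M p" "v \<in> tangent_space M p"
  shows "lincomb a u b v \<in> tangent_space M p"
proof -
  obtain U \<phi> w where c: "(U, \<phi>) \<in> atlas M" "p \<in> U" and u: "u = coord_derivation M U \<phi> p w"
    using tangent_spaceE[OF assms(1)] .
  obtain w' where v: "v = coord_derivation M U \<phi> p w'"
    using tangent_in_chart[OF assms(2) c] .
  have "lincomb a u b v = coord_derivation M U \<phi> p (a *\<^sub>R w + b *\<^sub>R w')"
  proof
    fix f
    show "lincomb a u b v f = coord_derivation M U \<phi> p (a *\<^sub>R w + b *\<^sub>R w') f"
    proof (cases "smooth_near M p f")
      case True
      have "linear (frechet_derivative (f \<circ> inv_into U \<phi>) (at (\<phi> p)))"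
        by (rule linear_frechet_derivative[OF smooth_near_differentiable[OF c True]])
      then show ?thesis
        by (simp add: lincomb_def u v coord_derivation_def linear_add linear_scale)
    qed (simp add: lincomb_def u v coord_derivation_def)
  qed
  then show ?thesis
    using coord_derivation_in_tangent_space[OF c] by simp
qed

lemma zero_in_tangent_space:
  assumes "p \<in> topspace (mtop M)"
  shows "(\<lambda>_. 0) \<in> tangent_space M p"
proof -
  obtain U \<phi> where c: "(U, \<phi>) \<in> atlas M" "p \<in> U"
    using chart_at[OF assms] .
  have "lincomb 0 (coord_derivation M U \<phi> p 0) 0 (coord_derivation M U \<phi> p 0) = (\<lambda>_. 0)"
    by (simp add: lincomb_def)
  then show ?thesis
    using lincomb_in_tangent_space coord_derivation_in_tangent_space[OF c] by metis
qed

section \<open>Vector fields and their brackets\<close>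

lemma vector_field_tangent: "vector_field M U X \<Longrightarrow> p \<in> U \<Longrightarrow> X p \<in> tangent_space M p"
  unfolding vector_field_def by blast

lemma vector_field_smooth:
  "vector_field M U X \<Longrightarrow> openin (mtop M) V \<Longrightarrow> V \<subseteq> U \<Longrightarrow> smooth_fun M V f \<Longrightarrow>
    smooth_fun M V (\<lambda>p. X p f)"
  unfolding vector_field_def by blast

lemma vector_field_cong:
  assumes X: "vector_field M U X" and eq: "\<And>p. p \<in> U \<Longrightarrow> X p = Y p"
  shows "vector_field M U Y"
  unfolding vector_field_def
proof (intro conjI ballI allI impI)
  fix p assume "p \<in> U"
  then show "Y p \<in> tangent_space M p"
    using vector_field_tangent[OF X] eq by fastforce
next
  fix V f assume V: "openin (mtop M) V \<and> V \<subseteq> U \<and> smooth_fun M V f"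
  show "smooth_fun M V (\<lambda>p. Y p f)"
    by (rule smooth_fun_cong[OF vector_field_smooth[OF X]]) (use V eq in \<open>auto simp: subset_iff\<close>)
qed

lemma vector_field_lincomb:
  assumes "vector_field M U X" "vector_field M U Y"
  shows "vector_field M U (\<lambda>p. lincomb a (X p) b (Y p))"
  using assms unfolding vector_field_def
  by (auto intro: lincomb_in_tangent_space) (simp add: lincomb_def smooth_fun_lincomb)

text \<open>Smoothness of a field is given through its action on functions, whereas the bracket
  needs components to differentiate; applying \<open>X\<close> to the coordinate functions produces
  them.\<close>

lemma vector_field_coordinates:
  assumes c: "(U, \<phi>) \<in> atlas M" and W: "openin (mtop M) W" "W \<subseteq> U" and X: "vector_field M W X"
  shows "\<exists>\<xi>. smooth_on (\<phi> ` W) \<xi> \<and> (\<forall>p\<in>W. X p = coord_derivation M U \<phi> p (\<xi> (\<phi> p)))"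
proof (intro exI conjI ballI)
  define \<xi> where "\<xi> y = (\<Sum>b\<in>Basis. X (inv_into U \<phi> y) (\<lambda>x. \<phi> x \<bullet> b) *\<^sub>R b)" for y
  have o: "open (\<phi> ` W)"
    by (rule chart_open_image[OF c W])
  have co: "smooth_fun M U (\<lambda>x. \<phi> x \<bullet> b)" for b
    by (rule smooth_fun_coordinate[OF c bounded_linear_inner_left])
  have "smooth_on (\<phi> ` W) (\<lambda>y. X (inv_into U \<phi> y) (\<lambda>x. \<phi> x \<bullet> b))" for b
    using smooth_fun_chart[OF vector_field_smooth[OF X W(1) subset_refl smooth_fun_subset[OF co W(2)]] c] W(2)
    by (simp add: comp_def Int_absorb2)
  then show "smooth_on (\<phi> ` W) \<xi>"
    unfolding \<xi>_def by (intro smooth_on_sum smooth_on_scaleR smooth_on_const o) auto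
  fix p assume p: "p \<in> W"
  then have pU: "p \<in> U" using W by blast
  obtain w where w: "X p = coord_derivation M U \<phi> p w"
    using tangent_in_chart[OF vector_field_tangent[OF X p] c pU] .
  have "X p (\<lambda>x. \<phi> x \<bullet> b) = w \<bullet> b" for b
  proof -
    have "smooth_near M p (\<lambda>x. \<phi> x \<bullet> b)"
      by (rule smooth_nearI[OF chart_openin[OF c] pU co])
    moreover have "((\<lambda>x. \<phi> x \<bullet> b) \<circ> inv_into U \<phi> has_derivative (\<lambda>v. v \<bullet> b)) (at (\<phi> p))"
    proof (rule has_derivative_transform_within_open[of "\<lambda>y. y \<bullet> b" _ _ _ "\<phi> ` W"])
      show "((\<lambda>y. y \<bullet> b) has_derivative (\<lambda>v. v \<bullet> b)) (at (\<phi> p))"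
        by (auto intro!: derivative_eq_intros)
    qed (use o p W in \<open>auto simp: chart_inv[OF c] subset_iff\<close>)
    ultimately show ?thesis
      by (simp add: w coord_derivation_def frechet_derivative_eq)
  qed
  then have "\<xi> (\<phi> p) = w"
    using pU by (simp add: \<xi>_def chart_inv[OF c] euclidean_representation)
  then show "X p = coord_derivation M U \<phi> p (\<xi> (\<phi> p))"
    using w by simp
qed

text \<open>
  In a chart where \<open>X\<close> and \<open>Y\<close> have coordinates \<open>\<xi>\<close> and \<open>\<eta>\<close>, the second derivatives cancel in
  \<open>X (Y f) - Y (X f)\<close>, which leaves the derivative of \<open>f\<close> in direction \<open>D\<eta>(\<xi>) - D\<xi>(\<eta>)\<close>.
\<close>

lemma bracket_in_tangent_space:
  assumes U: "openin (mtop M) U" and X: "vector_field M U X" and Y: "vector_field M U Y" and p: "p \<in> U"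
  shows "bracket M X Y p \<in> tangent_space M p"
proof -
  obtain V \<phi> where c: "(V, \<phi>) \<in> atlas M" "p \<in> V"
    using chart_at p openin_subset[OF U] by blast
  define W where "W = U \<inter> V"
  have W: "openin (mtop M) W" "W \<subseteq> V" "p \<in> W" "W \<subseteq> U"
    using U chart_openin[OF c(1)] p c(2) by (auto simp: W_def)
  have XY: "vector_field M W X" "vector_field M W Y"
    using X Y W(4) unfolding vector_field_def by blast+
  obtain \<xi> where xi: "smooth_on (\<phi> ` W) \<xi>" "\<And>p. p \<in> W \<Longrightarrow> X p = coord_derivation M V \<phi> p (\<xi> (\<phi> p))"
    using vector_field_coordinates[OF c(1) W(1,2) XY(1)] by blast
  obtain \<eta> where eta: "smooth_on (\<phi> ` W) \<eta>" "\<And>p. p \<in> W \<Longrightarrow> Y p = coord_derivation M V \<phi> p (\<eta> (\<phi> p))"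
    using vector_field_coordinates[OF c(1) W(1,2) XY(2)] by blast
  let ?b = "frechet_derivative \<eta> (at (\<phi> p)) (\<xi> (\<phi> p)) - frechet_derivative \<xi> (at (\<phi> p)) (\<eta> (\<phi> p))"
  have "bracket M X Y p f = coord_derivation M V \<phi> p ?b f" for f
  proof (cases "smooth_near M p f")
    case True
    then obtain T where T0: "openin (mtop M) T" "p \<in> T" "smooth_fun M T f"
      unfolding smooth_near_def by blast
    define S where "S = T \<inter> W"
    have S: "openin (mtop M) S" "p \<in> S" "S \<subseteq> W" "S \<subseteq> V" "S \<subseteq> U" "smooth_fun M S f"
      using T0 W smooth_fun_subset[OF T0(3)] by (auto simp: S_def)
    let ?F = "f \<circ> inv_into V \<phi>"
    have o: "open (\<phi> ` S)" and pS: "\<phi> p \<in> \<phi> ` S"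
      using chart_open_image[OF c(1) S(1,4)] S(2) by auto
    have F: "smooth_on (\<phi> ` S) ?F"
      using smooth_fun_chart[OF S(6) c(1)] S(4) by (simp add: Int_absorb2)
    have sm: "smooth_on (\<phi> ` S) \<xi>" "smooth_on (\<phi> ` S) \<eta>"
      by (rule smooth_on_subset[OF xi(1) image_mono[OF S(3)]],
        rule smooth_on_subset[OF eta(1) image_mono[OF S(3)]])
    \<comment> \<open>Formulated for arbitrary fields because both \<open>X (Y f)\<close> and
      \<open>Y (X f)\<close> have to be expanded.\<close>
    have second: "A p (\<lambda>q. B q f) =
        frechet_derivative ?F (at (\<phi> p)) (frechet_derivative \<beta> (at (\<phi> p)) (\<alpha> (\<phi> p))) +
        frechet_derivative (\<lambda>y. frechet_derivative ?F (at y) (\<alpha> (\<phi> p))) (at (\<phi> p)) (\<beta> (\<phi> p))"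
      if A: "\<And>p. p \<in> W \<Longrightarrow> A p = coord_derivation M V \<phi> p (\<alpha> (\<phi> p))"
        and B: "\<And>p. p \<in> W \<Longrightarrow> B p = coord_derivation M V \<phi> p (\<beta> (\<phi> p))"
        and vB: "vector_field M U B" and sb: "smooth_on (\<phi> ` S) \<beta>" for A B \<alpha> \<beta>
    proof -
      have near: "smooth_near M p (\<lambda>q. B q f)"
        by (rule smooth_nearI[OF S(1,2) vector_field_smooth[OF vB S(1,5,6)]])
      have "((\<lambda>q. B q f) \<circ> inv_into V \<phi>) y = frechet_derivative ?F (at y) (\<beta> y)"
        if "y \<in> \<phi> ` S" for y
      proof -
        obtain q where q: "q \<in> S" "y = \<phi> q" using \<open>y \<in> \<phi> ` S\<close> by blast
        have "smooth_near M q f" by (rule smooth_nearI[OF S(1) q(1) S(6)])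
        moreover have "q \<in> W" "q \<in> V" using q S by auto
        ultimately show ?thesis
          by (simp add: q B chart_inv[OF c(1)] coord_derivation_def)
      qed
      then have "frechet_derivative ((\<lambda>q. B q f) \<circ> inv_into V \<phi>) (at (\<phi> p)) =
          frechet_derivative (\<lambda>y. frechet_derivative ?F (at y) (\<beta> y)) (at (\<phi> p))"
        by (intro frechet_derivative_transform_within_open[OF smooth_near_differentiable[OF c near] o pS])
      then show ?thesis
        using near by (simp add: A[OF W(3)] coord_derivation_def derivative_along_field[OF F sb o pS])
    qed
    have lin: "linear (frechet_derivative ?F (at (\<phi> p)))"
      by (rule linear_frechet_derivative[OF smooth_on_differentiable[OF F pS]])
    show ?thesis
      using True second[OF xi(2) eta(2) Y sm(2)] second[OF eta(2) xi(2) X sm(1)]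
        second_derivative_symmetric[OF F o pS, of "\<xi> (\<phi> p)" "\<eta> (\<phi> p)"]
      by (simp add: bracket_def coord_derivation_def linear_diff[OF lin])
  qed (simp add: bracket_def coord_derivation_def)
  then have "bracket M X Y p = coord_derivation M V \<phi> p ?b" by blast
  then show ?thesis
    using coord_derivation_in_tangent_space[OF c] by simp
qed

lemma vector_field_bracket:
  assumes U: "openin (mtop M) U" and X: "vector_field M U X" and Y: "vector_field M U Y"
  shows "vector_field M U (bracket M X Y)"
  unfolding vector_field_def
proof (intro conjI ballI allI impI)
  fix p assume "p \<in> U"
  then show "bracket M X Y p \<in> tangent_space M p"
    by (rule bracket_in_tangent_space[OF assms])
next
  fix V f assume "openin (mtop M) V \<and> V \<subseteq> U \<and> smooth_fun M V f"
  then have V: "openin (mtop M) V" "V \<subseteq> U" "smooth_fun M V f" by auto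
  note sX = vector_field_smooth[OF X V(1,2)] and sY = vector_field_smooth[OF Y V(1,2)]
  show "smooth_fun M V (\<lambda>p. bracket M X Y p f)"
    by (rule smooth_fun_cong[OF smooth_fun_lincomb[OF sX[OF sY[OF V(3)]] sY[OF sX[OF V(3)]] V(1), of 1 "-1"] V(1)])
      (use smooth_nearI[OF V(1) _ V(3)] in \<open>simp add: bracket_def\<close>)
qed

section \<open>Pull-back of functions and tangent maps of smooth self-maps\<close>

lemma pullback_smooth_fun:
  assumes F: "smooth_map M M F" and V: "openin (mtop M) V" and f: "smooth_fun M V f"
  shows "smooth_fun M {x \<in> topspace (mtop M). F x \<in> V} (f \<circ> F)"
proof (rule smooth_funI)
  have Fc: "continuous_map (mtop M) (mtop M) F"
    using F unfolding smooth_map_def by blast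
  show "openin (mtop M) {x \<in> topspace (mtop M). F x \<in> V}"
    by (rule openin_continuous_map_preimage[OF Fc V])
  fix p assume p: "p \<in> {x \<in> topspace (mtop M). F x \<in> V}"
  then obtain U \<phi> where c: "(U, \<phi>) \<in> atlas M" "p \<in> U"
    using chart_at by blast
  obtain T \<psi> where c': "(T, \<psi>) \<in> atlas M" "F p \<in> T"
    using chart_at p openin_subset[OF V] by blast
  have VT: "openin (mtop M) (V \<inter> T)"
    using V chart_openin[OF c'(1)] by blast
  define W where "W = {x \<in> topspace (mtop M). F x \<in> V \<inter> T} \<inter> U"
  have W: "openin (mtop M) W" "p \<in> W" "W \<subseteq> U"
    unfolding W_def
    using p c(2) c' openin_continuous_map_preimage[OF Fc VT] chart_openin[OF c(1)] by auto
  have "smooth_on (\<phi> ` W) (\<psi> \<circ> F \<circ> inv_into U \<phi>)"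
    by (rule smooth_on_subset[where S = "\<phi> ` {x \<in> U. F x \<in> T}"])
      (use F c c' in \<open>auto simp: smooth_map_def W_def\<close>)
  then have "smooth_on (\<phi> ` W) ((f \<circ> inv_into T \<psi>) \<circ> (\<psi> \<circ> F \<circ> inv_into U \<phi>))"
    by (rule smooth_on_compose[OF smooth_fun_chart[OF f c'(1)]])
      (use chart_open_image[OF c(1) W(1,3)] chart_open_image[OF c'(1) VT] in
        \<open>auto simp: W_def chart_inv[OF c(1)]\<close>)
  then have "smooth_on (\<phi> ` W) ((f \<circ> F) \<circ> inv_into U \<phi>)"
    by (rule smooth_on_cong)
      (use chart_open_image[OF c(1) W(1,3)] in \<open>auto simp: W_def chart_inv[OF c(1)] chart_inv[OF c'(1)]\<close>)
  then show "\<exists>V \<phi> W. (V, \<phi>) \<in> atlas M \<and> openin (mtop M) W \<and> p \<in> W \<and> W \<subseteq> V \<and>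
      smooth_on (\<phi> ` W) (f \<circ> F \<circ> inv_into V \<phi>)"
    using c W by blast
qed

lemma pullback_smooth_near:
  assumes F: "smooth_map M M F" and p: "p \<in> topspace (mtop M)" and f: "smooth_near M (F p) f"
  shows "smooth_near M p (f \<circ> F)"
proof -
  obtain V where V: "openin (mtop M) V" "F p \<in> V" "smooth_fun M V f"
    using f unfolding smooth_near_def by blast
  show ?thesis
    by (rule smooth_nearI[OF openin_continuous_map_preimage[OF _ V(1)] _ pullback_smooth_fun[OF F V(1,3)]])
      (use F p V in \<open>auto simp: smooth_map_def\<close>)
qed

text \<open>Tangent vectors are by definition coordinate derivations, so components have to be
  produced: by the chain rule they are the derivative of \<open>F\<close> in charts, applied to
  \<open>w\<close>.\<close>

lemma tangent_map_in_tangent_space: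
  assumes F: "smooth_map M M F" and u: "u \<in> tangent_space M p"
  shows "tangent_map M F p u \<in> tangent_space M (F p)"
proof -
  obtain U \<phi> w where c: "(U, \<phi>) \<in> atlas M" "p \<in> U" and ueq: "u = coord_derivation M U \<phi> p w"
    using tangent_spaceE[OF u] .
  have p: "p \<in> topspace (mtop M)" using c chart_subset by blast
  have Fc: "continuous_map (mtop M) (mtop M) F"
    using F unfolding smooth_map_def by blast
  then have "F p \<in> topspace (mtop M)" using p by (auto simp: continuous_map_def)
  then obtain T \<psi> where c': "(T, \<psi>) \<in> atlas M" "F p \<in> T"
    using chart_at by blast
  let ?t = "\<psi> \<circ> F \<circ> inv_into U \<phi>"
  define W where "W = {x \<in> topspace (mtop M). F x \<in> T}"
  have W: "openin (mtop M) W" "p \<in> W"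
    unfolding W_def using openin_continuous_map_preimage[OF Fc chart_openin[OF c'(1)]] p c' by auto
  have "smooth_on (\<phi> ` {x \<in> U. F x \<in> T}) ?t"
    using F c c' by (auto simp: smooth_map_def)
  then have dt: "?t differentiable at (\<phi> p)"
    by (rule smooth_on_differentiable) (use c c' in auto)
  have "frechet_derivative (f \<circ> F \<circ> inv_into U \<phi>) (at (\<phi> p)) w =
      frechet_derivative (f \<circ> inv_into T \<psi>) (at (\<psi> (F p))) (frechet_derivative ?t (at (\<phi> p)) w)"
    if f: "smooth_near M (F p) f" for f
  proof -
    have "frechet_derivative ((f \<circ> F) \<circ> inv_into U \<phi>) (at (\<phi> p)) =
        frechet_derivative ((f \<circ> inv_into T \<psi> \<circ> \<psi> \<circ> F) \<circ> inv_into U \<phi>) (at (\<phi> p))"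
      by (rule chart_germ_cong[OF c W _ smooth_near_differentiable[OF c pullback_smooth_near[OF F p f]]])
        (simp add: W_def chart_inv[OF c'(1)])
    also have "\<dots> = frechet_derivative ((f \<circ> inv_into T \<psi>) \<circ> ?t) (at (\<phi> p))"
      by (simp add: comp_assoc)
    also have "\<dots> = frechet_derivative (f \<circ> inv_into T \<psi>) (at (?t (\<phi> p))) \<circ>
        frechet_derivative ?t (at (\<phi> p))"
      by (rule frechet_derivative_compose[OF dt])
        (use smooth_near_differentiable[OF c' f] c in \<open>simp add: chart_inv[OF c(1)]\<close>)
    finally show ?thesis
      by (simp add: chart_inv[OF c(1)] c)
  qed
  then have "tangent_map M F p u = coord_derivation M T \<psi> (F p) (frechet_derivative ?t (at (\<phi> p)) w)"
    using pullback_smooth_near[OF F p] by (auto simp: ueq coord_derivation_def tangent_map_def)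
  then show ?thesis
    using coord_derivation_in_tangent_space[OF c'] by simp
qed

end

section \<open>Related vector fields\<close>

context smooth_mfd
begin

text \<open>Relatedness says X'(f) o F = X(f o F); using it twice moves each of the two terms of the
  bracket from \<open>N\<close> to \<open>M\<close>. Smoothness of \<open>F\<close> enters as the
  property \<open>pull\<close>, a form that left translations and the projection to the quotient
  both provide.\<close>

lemma bracket_related:
  fixes N :: "('b, 'f::euclidean_space) manifold"
  assumes pull: "\<And>V f. openin (mtop N) V \<Longrightarrow> smooth_fun N V f \<Longrightarrow>
      openin (mtop M) {x \<in> topspace (mtop M). F x \<in> V} \<and>
      smooth_fun M {x \<in> topspace (mtop M). F x \<in> V} (f \<circ> F)"
    and X: "vector_field M (topspace (mtop M)) X" and Y: "vector_field M (topspace (mtop M)) Y"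
    and X': "vector_field N (topspace (mtop N)) X'" and Y': "vector_field N (topspace (mtop N)) Y'"
    and relX: "\<And>p. p \<in> topspace (mtop M) \<Longrightarrow> X' (F p) = tangent_map N F p (X p)"
    and relY: "\<And>p. p \<in> topspace (mtop M) \<Longrightarrow> Y' (F p) = tangent_map N F p (Y p)"
    and p: "p \<in> topspace (mtop M)"
  shows "bracket N X' Y' (F p) = tangent_map N F p (bracket M X Y p)"
proof
  fix f
  show "bracket N X' Y' (F p) f = tangent_map N F p (bracket M X Y p) f"
  proof (cases "smooth_near N (F p) f")
    case True
    then obtain V where V: "openin (mtop N) V" "F p \<in> V" "smooth_fun N V f"
      unfolding smooth_near_def by blast
    define W where "W = {x \<in> topspace (mtop M). F x \<in> V}"
    have W: "openin (mtop M) W" "p \<in> W" "smooth_fun M W (f \<circ> F)"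
      using pull[OF V(1,3)] p V(2) unfolding W_def by auto
    have second: "A' (F p) (\<lambda>q. B' q f) = A p (\<lambda>q. B q (f \<circ> F))"
      if A: "vector_field M (topspace (mtop M)) A"
        and B': "vector_field N (topspace (mtop N)) B'"
        and relA: "\<And>p. p \<in> topspace (mtop M) \<Longrightarrow> A' (F p) = tangent_map N F p (A p)"
        and relB: "\<And>p. p \<in> topspace (mtop M) \<Longrightarrow> B' (F p) = tangent_map N F p (B p)"
      for A B A' B'
    proof -
      have "smooth_fun N V (\<lambda>q. B' q f)"
        using B' V openin_subset[OF V(1)] unfolding vector_field_def by blast
      then have "smooth_near N (F p) (\<lambda>q. B' q f)"
        using V unfolding smooth_near_def by blast
      then have "A' (F p) (\<lambda>q. B' q f) = A p ((\<lambda>q. B' q f) \<circ> F)"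
        by (simp add: relA[OF p] tangent_map_def)
      also have "\<dots> = A p (\<lambda>q. B q (f \<circ> F))"
      proof (rule tangent_cong[OF vector_field_tangent[OF A p] W(1,2)])
        fix q assume q: "q \<in> W"
        then have "smooth_near N (F q) f"
          using V unfolding smooth_near_def W_def by blast
        then show "((\<lambda>q. B' q f) \<circ> F) q = B q (f \<circ> F)"
          using q relB by (simp add: W_def tangent_map_def)
      qed
      finally show ?thesis .
    qed
    show ?thesis
      using True smooth_nearI[OF W]
      by (simp add: bracket_def tangent_map_def second[OF X Y' relX relY] second[OF Y X' relY relX] comp_def)
  qed (simp add: bracket_def tangent_map_def)
qed

end

section \<open>Left-invariant vector fields on a Lie group\<close>

locale lie_grp =
  fixes G :: "('a, 'm) monoid_scheme" (structure)
    and M :: "('a, 'e::euclidean_space) manifold"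
  assumes lie: "lie_group G M"

sublocale lie_grp \<subseteq> smooth_mfd M
  using lie by unfold_locales (simp add: lie_group_def)

sublocale lie_grp \<subseteq> group G
  using lie by (simp add: lie_group_def)

context lie_grp
begin

lemma topspace_carrier: "topspace (mtop M) = carrier G"
  using lie by (simp add: lie_group_def)

text \<open>A rectangle in coordinates lets one factor be treated separately: freezing the first
  gives smoothness of left translations, differentiating in the second gives smoothness of
  left-invariant fields. Confining the products to \<open>Q\<close> allows composition with
  functions that are smooth only there.\<close>

lemma mult_chart:
  assumes c: "(U, \<phi>) \<in> atlas M" "a \<in> U" and d: "(V, \<psi>) \<in> atlas M" "b \<in> V"
    and e: "(T, \<tau>) \<in> atlas M" and Q: "openin (mtop M) Q" "a \<otimes> b \<in> Q" "Q \<subseteq> T"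
  obtains A B where "open A" "open B" "\<phi> a \<in> A" "\<psi> b \<in> B" "A \<subseteq> \<phi> ` U" "B \<subseteq> \<psi> ` V"
    "\<And>y z. y \<in> A \<Longrightarrow> z \<in> B \<Longrightarrow> inv_into U \<phi> y \<otimes> inv_into V \<psi> z \<in> Q"
    "smooth_on (A \<times> B) (\<lambda>(y, z). \<tau> (inv_into U \<phi> y \<otimes> inv_into V \<psi> z))"
proof -
  let ?m = "\<lambda>(x, y). x \<otimes> y"
  have sm: "smooth_map (product_manifold M M) M ?m"
    using lie by (simp add: lie_group_def)
  then have mc: "continuous_map (prod_topology (mtop M) (mtop M)) (mtop M) ?m"
    by (simp add: smooth_map_def product_manifold_def)
  define P where "P = {z \<in> topspace (prod_topology (mtop M) (mtop M)). ?m z \<in> Q}"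
  have "openin (prod_topology (mtop M) (mtop M)) P"
    unfolding P_def by (rule openin_continuous_map_preimage[OF mc Q(1)])
  moreover have "(a, b) \<in> P"
    using c d Q(2) chart_subset[OF c(1)] chart_subset[OF d(1)] by (auto simp: P_def)
  ultimately obtain X Y where X: "openin (mtop M) X" "a \<in> X" and Y: "openin (mtop M) Y" "b \<in> Y"
    and XY: "X \<times> Y \<subseteq> P"
    unfolding openin_prod_topology_alt by blast
  define A where "A = \<phi> ` (X \<inter> U)"
  define B where "B = \<psi> ` (Y \<inter> V)"
  have oA: "open A"
    unfolding A_def using X chart_openin[OF c(1)] by (intro chart_open_image[OF c(1)]) auto
  have oB: "open B"
    unfolding B_def using Y chart_openin[OF d(1)] by (intro chart_open_image[OF d(1)]) auto
  have inQ: "inv_into U \<phi> y \<otimes> inv_into V \<psi> z \<in> Q" if yz: "y \<in> A" "z \<in> B" for y z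
  proof -
    obtain x x' where x: "x \<in> X \<inter> U" "y = \<phi> x" "x' \<in> Y \<inter> V" "z = \<psi> x'"
      using yz unfolding A_def B_def by blast
    then have "(x, x') \<in> P" using XY by auto
    then show ?thesis
      using x by (simp add: P_def chart_inv[OF c(1)] chart_inv[OF d(1)])
  qed
  have inj: "inj_on (map_prod \<phi> \<psi>) (U \<times> V)"
    by (rule map_prod_inj_on[OF chart_inj[OF c(1)] chart_inj[OF d(1)]])
  have inv: "inv_into (U \<times> V) (map_prod \<phi> \<psi>) (\<phi> x, \<psi> y) = (x, y)" if "x \<in> U" "y \<in> V" for x y
    using inv_into_f_f[OF inj, of "(x, y)"] that by simp
  have at: "(U \<times> V, map_prod \<phi> \<psi>) \<in> atlas (product_manifold M M)"
    using c d by (auto simp: product_manifold_def)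
  have "\<forall>(U, \<phi>) \<in> atlas (product_manifold M M). \<forall>(V, \<psi>) \<in> atlas M.
      smooth_on (\<phi> ` {x \<in> U. ?m x \<in> V}) (\<psi> \<circ> ?m \<circ> inv_into U \<phi>)"
    using sm by (simp add: smooth_map_def)
  from bspec[OF bspec[OF this at, unfolded prod.case] e]
  have "smooth_on (map_prod \<phi> \<psi> ` {x \<in> U \<times> V. ?m x \<in> T}) (\<tau> \<circ> ?m \<circ> inv_into (U \<times> V) (map_prod \<phi> \<psi>))"
    by simp
  moreover have "A \<times> B \<subseteq> map_prod \<phi> \<psi> ` {x \<in> U \<times> V. ?m x \<in> T}"
  proof clarify
    fix y z assume yz: "y \<in> A" "z \<in> B"
    then obtain x x' where x: "x \<in> X \<inter> U" "y = \<phi> x" "x' \<in> Y \<inter> V" "z = \<psi> x'"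
      unfolding A_def B_def by blast
    then have "x \<otimes> x' \<in> T"
      using inQ[OF yz] Q(3) by (auto simp: chart_inv[OF c(1)] chart_inv[OF d(1)])
    then show "(y, z) \<in> map_prod \<phi> \<psi> ` {x \<in> U \<times> V. ?m x \<in> T}"
      using x by (intro image_eqI[of _ _ "(x, x')"]) auto
  qed
  ultimately have "smooth_on (A \<times> B) (\<tau> \<circ> ?m \<circ> inv_into (U \<times> V) (map_prod \<phi> \<psi>))"
    by (rule smooth_on_subset)
  then have "smooth_on (A \<times> B) (\<lambda>(y, z). \<tau> (inv_into U \<phi> y \<otimes> inv_into V \<psi> z))"
    by (rule smooth_on_cong)
      (use oA oB in \<open>auto simp: open_Times A_def B_def inv chart_inv[OF c(1)] chart_inv[OF d(1)]\<close>)
  then show ?thesis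
    by (intro that[OF oA oB _ _ _ _ inQ]) (use X Y c d in \<open>auto simp: A_def B_def\<close>)
qed

lemma smooth_left_mult:
  assumes a: "a \<in> carrier G"
  shows "smooth_map M M (\<lambda>x. a \<otimes> x)"
  unfolding smooth_map_def
proof (intro conjI ballI, goal_cases)
  case 1
  have mc: "continuous_map (prod_topology (mtop M) (mtop M)) (mtop M) (\<lambda>(x, y). x \<otimes> y)"
    using lie by (simp add: lie_group_def smooth_map_def product_manifold_def)
  have "continuous_map (mtop M) (prod_topology (mtop M) (mtop M)) (\<lambda>x. (a, x))"
    using a by (intro continuous_map_pairedI) (auto simp: topspace_carrier)
  from continuous_map_compose[OF this mc] show ?case
    by (simp add: comp_def)
next
  case (2 c')
  obtain V \<psi> where "c' = (V, \<psi>)" by (cases c')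
  with 2 have d: "(V, \<psi>) \<in> atlas M" by simp
  have "smooth_on (\<psi> ` {x \<in> V. a \<otimes> x \<in> T}) (\<tau> \<circ> (\<otimes>) a \<circ> inv_into V \<psi>)"
    if e: "(T, \<tau>) \<in> atlas M" for T \<tau>
  proof (rule smooth_on_local)
    fix y assume "y \<in> \<psi> ` {x \<in> V. a \<otimes> x \<in> T}"
    then obtain b where b: "b \<in> V" "a \<otimes> b \<in> T" "y = \<psi> b" by auto
    obtain U \<phi> where c: "(U, \<phi>) \<in> atlas M" "a \<in> U"
      using chart_at a topspace_carrier by blast
    obtain A B where AB: "open A" "open B" "\<phi> a \<in> A" "\<psi> b \<in> B"
      and sm: "smooth_on (A \<times> B) (\<lambda>(y, z). \<tau> (inv_into U \<phi> y \<otimes> inv_into V \<psi> z))"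
      using mult_chart[OF c d b(1) e chart_openin[OF e] b(2) order_refl] by metis
    have "smooth_on B (\<lambda>z. (\<phi> a, z))"
      by (intro smooth_on_Pair smooth_on_const smooth_on_linear_map bounded_linear_ident AB)
    from smooth_on_compose[OF sm this AB(2) open_Times[OF AB(1,2)]] AB(3)
    have "smooth_on B (\<tau> \<circ> (\<otimes>) a \<circ> inv_into V \<psi>)"
      by (auto simp: comp_def chart_inv[OF c(1)] c(2))
    then show "\<exists>T. open T \<and> y \<in> T \<and> smooth_on T (\<tau> \<circ> (\<otimes>) a \<circ> inv_into V \<psi>)"
      using AB b by blast
  qed
  then show ?case
    unfolding \<open>c' = (V, \<psi>)\<close> by blast
qed

abbreviation "dL a p u \<equiv> left_translate G M a p u"

lemma left_translate_tangent:
  "a \<in> carrier G \<Longrightarrow> u \<in> tangent_space M p \<Longrightarrow> dL a p u \<in> tangent_space M (a \<otimes> p)"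
  using tangent_map_in_tangent_space[OF smooth_left_mult] .

lemma left_translate_mult:
  assumes "a \<in> carrier G" "b \<in> carrier G" "p \<in> carrier G" and u: "u \<in> tangent_space M p"
  shows "dL a (b \<otimes> p) (dL b p u) = dL (a \<otimes> b) p u"
proof
  fix f
  show "dL a (b \<otimes> p) (dL b p u) f = dL (a \<otimes> b) p u f"
  proof (cases "smooth_near M (a \<otimes> b \<otimes> p) f")
    case True
    have "smooth_near M (b \<otimes> p) (f \<circ> (\<otimes>) a)"
      by (rule pullback_smooth_near[OF smooth_left_mult]) (use True assms in \<open>auto simp: topspace_carrier m_assoc\<close>)
    moreover have "u (f \<circ> (\<otimes>) a \<circ> (\<otimes>) b) = u (f \<circ> (\<otimes>) (a \<otimes> b))"
      by (rule tangent_cong[OF u openin_topspace]) (use assms in \<open>auto simp: topspace_carrier m_assoc\<close>)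
    ultimately show ?thesis
      using True assms by (simp add: tangent_map_def m_assoc)
  qed (use assms in \<open>simp add: tangent_map_def m_assoc\<close>)
qed

lemma left_translate_one:
  assumes "p \<in> carrier G" and u: "u \<in> tangent_space M p"
  shows "dL \<one> p u = u"
proof
  fix f
  show "dL \<one> p u f = u f"
  proof (cases "smooth_near M p f")
    case True
    have "u (f \<circ> (\<otimes>) \<one>) = u f"
      by (rule tangent_cong[OF u openin_topspace]) (use assms in \<open>auto simp: topspace_carrier\<close>)
    then show ?thesis
      using True assms by (simp add: tangent_map_def)
  qed (use assms tangent_space_nonsmooth[OF u] in \<open>simp add: tangent_map_def\<close>)
qed

section \<open>The Lie algebra of left-invariant fields\<close>

lemma lie_algebraI:
  "vector_field M (carrier G) X \<Longrightarrow>
   (\<And>a p. a \<in> carrier G \<Longrightarrow> p \<in> carrier G \<Longrightarrow> X (a \<otimes> p) = dL a p (X p)) \<Longrightarrow>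
   (\<And>p. p \<notin> carrier G \<Longrightarrow> X p = (\<lambda>_. 0)) \<Longrightarrow> X \<in> lie_algebra G M"
  unfolding lie_algebra_def by blast

lemma lie_algebra_field: "X \<in> lie_algebra G M \<Longrightarrow> vector_field M (carrier G) X"
  unfolding lie_algebra_def by blast

lemma lie_algebra_tangent: "X \<in> lie_algebra G M \<Longrightarrow> p \<in> carrier G \<Longrightarrow> X p \<in> tangent_space M p"
  using lie_algebra_field vector_field_tangent by blast

lemma lie_algebra_translate:
  "X \<in> lie_algebra G M \<Longrightarrow> a \<in> carrier G \<Longrightarrow> p \<in> carrier G \<Longrightarrow> X (a \<otimes> p) = dL a p (X p)"
  unfolding lie_algebra_def by blast

lemma lie_algebra_off: "X \<in> lie_algebra G M \<Longrightarrow> p \<notin> carrier G \<Longrightarrow> X p = (\<lambda>_. 0)"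
  unfolding lie_algebra_def by blast

lemma carrier_openin: "openin (mtop M) (carrier G)"
  using topspace_carrier openin_topspace by metis

text \<open>The derivative of \<open>f\<close> along the field at \<open>a\<close> is the partial
  derivative of (a, b) -> f(a b) in the second variable, taken at the identity. It is smooth in
  \<open>a\<close> because multiplication is jointly smooth.\<close>

lemma left_invariant_extension:
  assumes u: "u \<in> tangent_space M \<one>"
  shows "(\<lambda>a. if a \<in> carrier G then dL a \<one> u else (\<lambda>_. 0)) \<in> lie_algebra G M" (is "?X \<in> _")
proof (rule lie_algebraI)
  show "vector_field M (carrier G) ?X"
    unfolding vector_field_def
  proof (intro conjI ballI allI impI)
    fix p assume p: "p \<in> carrier G"
    then show "?X p \<in> tangent_space M p"
      using left_translate_tangent[OF p u] by simp
  next
    fix W f assume "openin (mtop M) W \<and> W \<subseteq> carrier G \<and> smooth_fun M W f"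
    then have W: "openin (mtop M) W" "W \<subseteq> carrier G" "smooth_fun M W f" by auto
    obtain V \<psi> w where d: "(V, \<psi>) \<in> atlas M" "\<one> \<in> V" and ueq: "u = coord_derivation M V \<psi> \<one> w"
      using tangent_spaceE[OF u] .
    show "smooth_fun M W (\<lambda>p. ?X p f)"
    proof (rule smooth_funI[OF W(1)])
      fix a assume a: "a \<in> W"
      then obtain U \<phi> where c: "(U, \<phi>) \<in> atlas M" "a \<in> U"
        using chart_at W(2) topspace_carrier by blast
      have Q: "openin (mtop M) (W \<inter> U)" "a \<otimes> \<one> \<in> W \<inter> U" "W \<inter> U \<subseteq> U"
        using W a c chart_openin[OF c(1)] by auto
      obtain A B where AB: "open A" "open B" "\<phi> a \<in> A" "\<psi> \<one> \<in> B" "A \<subseteq> \<phi> ` U" "B \<subseteq> \<psi> ` V"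
        and inQ: "\<And>y z. y \<in> A \<Longrightarrow> z \<in> B \<Longrightarrow> inv_into U \<phi> y \<otimes> inv_into V \<psi> z \<in> W \<inter> U"
        and sm: "smooth_on (A \<times> B) (\<lambda>(y, z). \<phi> (inv_into U \<phi> y \<otimes> inv_into V \<psi> z))"
        using mult_chart[OF c d c(1) Q] by metis
      define F where "F = (\<lambda>(y, z). f (inv_into U \<phi> y \<otimes> inv_into V \<psi> z))"
      have oAB: "open (A \<times> B)" using AB open_Times by blast
      have im: "(\<lambda>(y, z). \<phi> (inv_into U \<phi> y \<otimes> inv_into V \<psi> z)) ` (A \<times> B) \<subseteq> \<phi> ` (W \<inter> U)"
        using inQ by force
      have "smooth_on (A \<times> B)
          ((f \<circ> inv_into U \<phi>) \<circ> (\<lambda>(y, z). \<phi> (inv_into U \<phi> y \<otimes> inv_into V \<psi> z)))"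
        by (rule smooth_on_compose[OF smooth_fun_chart[OF W(3) c(1)] sm oAB chart_open_image[OF c(1) Q(1,3)] im])
      then have F: "smooth_on (A \<times> B) F"
        by (rule smooth_on_cong[OF _ oAB]) (use inQ in \<open>auto simp: F_def chart_inv[OF c(1)]\<close>)
      \<comment> \<open>The vector \<open>(0, w)\<close> differentiates in the second variable only,
        in the direction that represents \<open>u\<close>.\<close>
      define D where "D = (\<lambda>y. frechet_derivative F (at (y, \<psi> \<one>)) (0, w))"
      have "smooth_on A ((\<lambda>q. frechet_derivative F (at q) (0, w)) \<circ> (\<lambda>y. (y, \<psi> \<one>)))"
        by (intro smooth_on_compose[OF smooth_on_derivative[OF F] _ AB(1) oAB] smooth_on_Pair
            smooth_on_const smooth_on_linear_map bounded_linear_ident AB(1)) (use AB(4) in auto)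
      then have D: "smooth_on A D"
        by (simp add: D_def comp_def)
      have XD: "?X (inv_into U \<phi> y) f = D y" if y: "y \<in> A" for y
      proof -
        define x where "x = inv_into U \<phi> y"
        have x: "x \<in> U" "x \<in> carrier G"
          using y AB(5) chart_subset[OF c(1)] inv_into_into[of y \<phi> U]
          by (auto simp: x_def topspace_carrier)
        have "x \<otimes> \<one> \<in> W"
          using inQ[OF y AB(4)] d by (simp add: x_def chart_inv[OF d(1)])
        then have near: "smooth_near M (x \<otimes> \<one>) f"
          by (rule smooth_nearI[OF W(1) _ W(3)])
        then have near1: "smooth_near M \<one> (f \<circ> (\<otimes>) x)"
          by (intro pullback_smooth_near[OF smooth_left_mult[OF x(2)]]) (auto simp: topspace_carrier)
        have 1: "((\<lambda>z. (y, z)) has_derivative (\<lambda>v. (0, v))) (at (\<psi> \<one>))"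
          by (auto intro!: derivative_eq_intros)
        have 2: "(F has_derivative frechet_derivative F (at (y, \<psi> \<one>))) (at (y, \<psi> \<one>))"
          using smooth_on_differentiable[OF F, of "(y, \<psi> \<one>)"] y AB(4)
          by (simp add: frechet_derivative_works[symmetric])
        have "((f \<circ> (\<otimes>) x) \<circ> inv_into V \<psi> has_derivative
            (\<lambda>v. frechet_derivative F (at (y, \<psi> \<one>)) (0, v))) (at (\<psi> \<one>))"
          using diff_chain_at[OF 1 2] by (simp add: comp_def F_def x_def)
        then show ?thesis
          using x near near1
          by (simp add: x_def[symmetric] tangent_map_def ueq coord_derivation_def D_def frechet_derivative_eq)
      qed
      define S where "S = {x \<in> U. \<phi> x \<in> A}"
      have S: "openin (mtop M) S" "a \<in> S" "S \<subseteq> U"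
        using chart_preimage_openin[OF c(1) AB(1)] c AB by (auto simp: S_def)
      have "\<phi> ` S = A" using AB(5) by (auto simp: S_def)
      moreover have "smooth_on A ((\<lambda>p. ?X p f) \<circ> inv_into U \<phi>)"
        by (rule smooth_on_cong[OF D AB(1)]) (simp add: XD del: if_split)
      ultimately show "\<exists>V \<phi> W. (V, \<phi>) \<in> atlas M \<and> openin (mtop M) W \<and> a \<in> W \<and> W \<subseteq> V \<and>
          smooth_on (\<phi> ` W) ((\<lambda>p. ?X p f) \<circ> inv_into V \<phi>)"
        using c S by (intro exI[of _ U] exI[of _ \<phi>] exI[of _ S]) simp
    qed
  qed
next
  fix a p assume "a \<in> carrier G" "p \<in> carrier G"
  then show "?X (a \<otimes> p) = dL a p (?X p)"
    using left_translate_mult[of a p \<one> u] u by simp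
qed simp

text \<open>Translating \<open>u\<close> back to the identity and extending it gives the field.
  Hence a one-form that is nonzero anywhere is nonzero on some left-invariant field.\<close>

lemma lie_algebra_through:
  assumes p: "p \<in> carrier G" and u: "u \<in> tangent_space M p"
  obtains X where "X \<in> lie_algebra G M" "X p = u"
proof -
  define v where "v = dL (inv p) p u"
  have v: "v \<in> tangent_space M \<one>"
    using left_translate_tangent[OF inv_closed[OF p] u] p by (simp add: v_def)
  have "dL p \<one> v = u"
    using left_translate_mult[OF p inv_closed[OF p] p u] p by (simp add: v_def left_translate_one[OF p u])
  then show ?thesis
    using that[OF left_invariant_extension[OF v]] p by simp
qed

lemma tangent_map_lincomb: "tangent_map N F p (lincomb a u b v) = lincomb a (tangent_map N F p u) b (tangent_map N F p v)"
  by (auto simp: tangent_map_def lincomb_def)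

lemma lie_algebra_lincomb:
  assumes "X \<in> lie_algebra G M" "Y \<in> lie_algebra G M"
  shows "(\<lambda>p. lincomb a (X p) b (Y p)) \<in> lie_algebra G M"
  using assms
  by (intro lie_algebraI vector_field_lincomb)
    (auto simp: lie_algebra_field lie_algebra_translate lie_algebra_off tangent_map_lincomb, simp add: lincomb_def)

lemma lie_algebra_zero: "(\<lambda>_ _. 0) \<in> lie_algebra G M"
  unfolding lie_algebra_def vector_field_def
  by (auto simp: zero_in_tangent_space topspace_carrier smooth_fun_const tangent_map_def)

text \<open>Left-invariance means being related to itself by every left translation, so
  \<open>bracket_related\<close> applies with both fields unchanged.\<close>

lemma lie_algebra_bracket:
  assumes X: "X \<in> lie_algebra G M" and Y: "Y \<in> lie_algebra G M"
  shows "bracket M X Y \<in> lie_algebra G M"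
proof (rule lie_algebraI)
  show "vector_field M (carrier G) (bracket M X Y)"
    by (rule vector_field_bracket[OF carrier_openin lie_algebra_field[OF X] lie_algebra_field[OF Y]])
next
  fix a p assume a: "a \<in> carrier G" and p: "p \<in> carrier G"
  show "bracket M X Y (a \<otimes> p) = dL a p (bracket M X Y p)"
  proof (rule bracket_related)
    fix V f assume "openin (mtop M) V" "smooth_fun M V f"
    then show "openin (mtop M) {x \<in> topspace (mtop M). a \<otimes> x \<in> V} \<and>
        smooth_fun M {x \<in> topspace (mtop M). a \<otimes> x \<in> V} (f \<circ> (\<otimes>) a)"
      using pullback_smooth_fun[OF smooth_left_mult[OF a]] smooth_left_mult[OF a]
        openin_continuous_map_preimage unfolding smooth_map_def by blast
  qed (use X Y a p in \<open>auto simp: topspace_carrier lie_algebra_field lie_algebra_translate\<close>)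
next
  fix p assume "p \<notin> carrier G"
  \<comment> \<open>Off the carrier no function is smooth nearby, so the default branch of
    \<open>bracket\<close> yields the normalisation.\<close>
  then have "\<not> smooth_near M p f" for f
    using smooth_near_topspace[of p f] by (auto simp: topspace_carrier)
  then show "bracket M X Y p = (\<lambda>_. 0)"
    by (simp add: bracket_def)
qed

text \<open>Reduces a finite sum of fields to adding one multiple at a time, which matches the
  linearity of forms, stated for \<open>lincomb\<close>. Membership in the Lie algebra is carried
  along because the step asks for it.\<close>

lemma field_span_induct:
  assumes "Z \<in> field_span S" "S \<subseteq> lie_algebra G M"
    and zero: "P (\<lambda>_ _. 0)"
    and step: "\<And>c X Y. X \<in> S \<Longrightarrow> Y \<in> lie_algebra G M \<Longrightarrow> P Y \<Longrightarrow> P (\<lambda>p. lincomb c (X p) 1 (Y p))"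
  shows "Z \<in> lie_algebra G M \<and> P Z"
proof -
  obtain F c where F: "finite F" "F \<subseteq> S" and Z: "Z = (\<lambda>p f. \<Sum>W\<in>F. c W * W p f)"
    using assms(1) unfolding field_span_def by blast
  have "(\<lambda>p f. \<Sum>W\<in>F. c W * W p f) \<in> lie_algebra G M \<and> P (\<lambda>p f. \<Sum>W\<in>F. c W * W p f)"
    using F
  proof (induction F rule: finite_induct)
    case empty
    then show ?case using lie_algebra_zero zero by simp
  next
    case (insert W F)
    have "(\<lambda>p f. \<Sum>W\<in>insert W F. c W * W p f) = (\<lambda>p. lincomb (c W) (W p) 1 (\<lambda>f. \<Sum>W\<in>F. c W * W p f))"
      using insert.hyps by (simp add: lincomb_def)
    then show ?case
      using insert lie_algebra_lincomb[of W "\<lambda>p f. \<Sum>W\<in>F. c W * W p f"] step assms(2) by auto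
  qed
  then show ?thesis using Z by simp
qed

lemma field_span_superset: "S \<subseteq> field_span S"
proof
  fix X assume "X \<in> S"
  then show "X \<in> field_span S"
    unfolding field_span_def by (intro CollectI exI[of _ "{X}"] exI[of _ "\<lambda>_. 1"]) auto
qed

lemma lower_central_subset: "lower_central G M k \<subseteq> lie_algebra G M"
proof (induction k)
  case (Suc k)
  have "{bracket M X Y | X Y. X \<in> lie_algebra G M \<and> Y \<in> lower_central G M k} \<subseteq> lie_algebra G M"
    using Suc lie_algebra_bracket by blast
  then show ?case
    using field_span_induct[where P = "\<lambda>_. True"] by auto
qed simp

lemma bracket_lower_central:
  "X \<in> lie_algebra G M \<Longrightarrow> Y \<in> lower_central G M k \<Longrightarrow> bracket M X Y \<in> lower_central G M (Suc k)"
  using field_span_superset by force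

end

section \<open>Descending to the quotient by a discrete subgroup\<close>

locale lie_quotient = lie_grp G M
  for G :: "('a, 'm) monoid_scheme" (structure)
    and M :: "('a, 'e::euclidean_space) manifold" +
  fixes \<Gamma> :: "'a set"
  assumes sub: "subgroup \<Gamma> G"
    and discrete: "subtopology (mtop M) \<Gamma> = discrete_topology \<Gamma>"
begin

abbreviation "\<pi> \<equiv> coset_proj G \<Gamma>"
abbreviation "N \<equiv> quotient_manifold G M \<Gamma>"

lemma proj_eq_iff:
  assumes "x \<in> carrier G" "y \<in> carrier G"
  shows "\<pi> x = \<pi> y \<longleftrightarrow> x \<otimes> inv y \<in> \<Gamma>"
proof -
  have "\<pi> x = \<pi> y \<longleftrightarrow> x \<in> \<Gamma> #> y"
    using repr_independence[OF _ assms(2) sub, of x] rcos_self[OF assms(1) sub]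
    by (auto simp: coset_proj_def)
  then show ?thesis
    using subgroup.rcos_module[OF sub is_group assms(2,1)] by simp
qed

lemma proj_translate: "\<gamma> \<in> \<Gamma> \<Longrightarrow> x \<in> carrier G \<Longrightarrow> \<pi> (\<gamma> \<otimes> x) = \<pi> x"
  using proj_eq_iff[of "\<gamma> \<otimes> x" x] subgroup.mem_carrier[OF sub] by (simp add: m_assoc)

text \<open>\<open>topology\<close> gives back its defining predicate once \<open>istopology\<close>
  has been verified; preimages under the projection commute with intersections and unions.\<close>

lemma openin_quotient:
  "openin (mtop N) W \<longleftrightarrow> W \<subseteq> rcosets \<Gamma> \<and> openin (mtop M) {x \<in> carrier G. \<pi> x \<in> W}"
proof -
  have "istopology (\<lambda>W. W \<subseteq> rcosets \<Gamma> \<and> openin (mtop M) {x \<in> carrier G. \<pi> x \<in> W})"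
    unfolding istopology_def
  proof (intro conjI allI impI)
    fix S T
    assume S: "S \<subseteq> rcosets \<Gamma> \<and> openin (mtop M) {x \<in> carrier G. \<pi> x \<in> S}"
      and T: "T \<subseteq> rcosets \<Gamma> \<and> openin (mtop M) {x \<in> carrier G. \<pi> x \<in> T}"
    have eq: "{x \<in> carrier G. \<pi> x \<in> S \<inter> T} = {x \<in> carrier G. \<pi> x \<in> S} \<inter> {x \<in> carrier G. \<pi> x \<in> T}"
      by blast
    show "openin (mtop M) {x \<in> carrier G. \<pi> x \<in> S \<inter> T}"
      unfolding eq using S T by blast
    show "S \<inter> T \<subseteq> rcosets \<Gamma>" using S by blast
  next
    fix K assume K: "\<forall>S\<in>K. S \<subseteq> rcosets \<Gamma> \<and> openin (mtop M) {x \<in> carrier G. \<pi> x \<in> S}"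
    have "{x \<in> carrier G. \<pi> x \<in> \<Union> K} = (\<Union>S\<in>K. {x \<in> carrier G. \<pi> x \<in> S})"
      by blast
    then show "openin (mtop M) {x \<in> carrier G. \<pi> x \<in> \<Union> K}"
      using K by auto
    show "\<Union> K \<subseteq> rcosets \<Gamma>" using K by blast
  qed
  then show ?thesis
    by (simp add: quotient_manifold_def topology_inverse')
qed

lemma rcosets_eq: "rcosets \<Gamma> = \<pi> ` carrier G"
  by (auto simp: RCOSETS_def coset_proj_def)

lemma topspace_quotient: "topspace (mtop N) = \<pi> ` carrier G"
proof -
  have "{x \<in> carrier G. \<pi> x \<in> rcosets \<Gamma>} = carrier G"
    by (auto simp: rcosets_eq)
  then have "openin (mtop N) (rcosets \<Gamma>)"
    using carrier_openin by (simp add: openin_quotient)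
  then show ?thesis
    using openin_quotient[of "topspace (mtop N)"] openin_subset rcosets_eq by fastforce
qed

lemma proj_in_topspace: "p \<in> carrier G \<Longrightarrow> \<pi> p \<in> topspace (mtop N)"
  by (simp add: topspace_quotient)

lemma proj_preimage_openin: "openin (mtop N) W \<Longrightarrow> openin (mtop M) {x \<in> carrier G. \<pi> x \<in> W}"
  by (simp add: openin_quotient)

text \<open>Take \<open>W\<close> open with \<open>W \<inter> \<Gamma> = {\<one>}\<close>. Any two
  points x, y close enough to \<open>p\<close> have \<open>x \<otimes> inv y\<close> in
  \<open>W\<close>, and equal cosets put it in \<open>\<Gamma>\<close>, so x = y.\<close>

lemma proj_locally_injective:
  assumes p: "p \<in> carrier G"
  obtains U where "openin (mtop M) U" "p \<in> U" "inj_on \<pi> U"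
proof -
  let ?f = "\<lambda>z. fst z \<otimes> inv (snd z)"
  have "openin (subtopology (mtop M) \<Gamma>) {\<one>}"
    using subgroup.one_closed[OF sub] by (simp add: discrete)
  then obtain W where W: "openin (mtop M) W" "{\<one>} = W \<inter> \<Gamma>"
    by (auto simp: openin_subtopology)
  have mc: "continuous_map (prod_topology (mtop M) (mtop M)) (mtop M) (\<lambda>(x, y). x \<otimes> y)"
    using lie by (simp add: lie_group_def smooth_map_def product_manifold_def)
  have ic: "continuous_map (mtop M) (mtop M) (\<lambda>x. inv x)"
    using lie by (simp add: lie_group_def smooth_map_def)
  have "continuous_map (prod_topology (mtop M) (mtop M)) (prod_topology (mtop M) (mtop M))
      (\<lambda>z. (fst z, inv (snd z)))"
    using continuous_map_compose[OF continuous_map_snd ic]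
    by (intro continuous_map_pairedI continuous_map_fst) (simp add: comp_def)
  from continuous_map_compose[OF this mc]
  have fc: "continuous_map (prod_topology (mtop M) (mtop M)) (mtop M) ?f"
    by (simp add: comp_def)
  define P where "P = {z \<in> topspace (prod_topology (mtop M) (mtop M)). ?f z \<in> W}"
  have "openin (prod_topology (mtop M) (mtop M)) P"
    unfolding P_def by (rule openin_continuous_map_preimage[OF fc W(1)])
  moreover have "(p, p) \<in> P"
    using p W by (auto simp: P_def topspace_carrier)
  ultimately obtain X Y where X: "openin (mtop M) X" "p \<in> X" and Y: "openin (mtop M) Y" "p \<in> Y"
    and XY: "X \<times> Y \<subseteq> P"
    unfolding openin_prod_topology_alt by blast
  have "inj_on \<pi> (X \<inter> Y)"
  proof (rule inj_onI)
    fix x y assume xy: "x \<in> X \<inter> Y" "y \<in> X \<inter> Y" "\<pi> x = \<pi> y"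
    then have c: "x \<in> carrier G" "y \<in> carrier G"
      using openin_subset[OF X(1)] by (auto simp: topspace_carrier)
    have "(x, y) \<in> P" using xy XY by blast
    moreover have "x \<otimes> inv y \<in> \<Gamma>" using xy(3) proj_eq_iff[OF c] by blast
    ultimately have "x \<otimes> inv y = \<one>"
      using W(2) by (auto simp: P_def)
    then have "x = inv (inv y)"
      using c inv_equality[of x "inv y"] by auto
    then show "x = y" using c by simp
  qed
  then show ?thesis
    using that[of "X \<inter> Y"] X Y by blast
qed

text \<open>
  \<open>(U, V, \<phi>)\<close> stands for the chart of the quotient that is \<open>\<phi>\<close> transported along \<open>\<pi>\<close> from \<open>U \<subseteq> V\<close>.
\<close>

definition quot_chart :: "'a set \<Rightarrow> 'a set \<Rightarrow> ('a \<Rightarrow> 'e) \<Rightarrow> bool" where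
  "quot_chart U V \<phi> \<longleftrightarrow> (V, \<phi>) \<in> atlas M \<and> openin (mtop M) U \<and> U \<subseteq> V \<and> inj_on \<pi> U"

lemma atlas_quotient:
  "atlas N = {(\<pi> ` U, \<phi> \<circ> inv_into U \<pi>) | U V \<phi>. quot_chart U V \<phi>}"
  by (simp add: quotient_manifold_def quot_chart_def)

lemma quot_chart_at:
  assumes p: "p \<in> carrier G"
  obtains U V \<phi> where "quot_chart U V \<phi>" "p \<in> U"
proof -
  obtain U where U: "openin (mtop M) U" "p \<in> U" "inj_on \<pi> U"
    using proj_locally_injective[OF p] .
  obtain V \<phi> where c: "(V, \<phi>) \<in> atlas M" "p \<in> V"
    using chart_at p topspace_carrier by blast
  have "quot_chart (U \<inter> V) V \<phi>"
    using U c chart_openin[OF c(1)] by (auto simp: quot_chart_def intro: inj_on_subset)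
  then show ?thesis using that U c by blast
qed

lemma quot_chart_values:
  assumes q: "quot_chart U V \<phi>" and x: "x \<in> U"
  shows "(\<phi> \<circ> inv_into U \<pi>) (\<pi> x) = \<phi> x"
    and "inv_into (\<pi> ` U) (\<phi> \<circ> inv_into U \<pi>) (\<phi> x) = \<pi> x"
    and "inv_into V \<phi> (\<phi> x) = x"
    and "x \<in> carrier G"
proof -
  have c: "(V, \<phi>) \<in> atlas M" and U: "U \<subseteq> V" "inj_on \<pi> U"
    using q by (auto simp: quot_chart_def)
  have val: "(\<phi> \<circ> inv_into U \<pi>) (\<pi> x) = \<phi> x" if "x \<in> U" for x
    using U that by simp
  then show "(\<phi> \<circ> inv_into U \<pi>) (\<pi> x) = \<phi> x" using x .
  have "inj_on (\<phi> \<circ> inv_into U \<pi>) (\<pi> ` U)"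
  proof (rule inj_onI)
    fix a b assume "a \<in> \<pi> ` U" "b \<in> \<pi> ` U" and eq: "(\<phi> \<circ> inv_into U \<pi>) a = (\<phi> \<circ> inv_into U \<pi>) b"
    then obtain s t where st: "s \<in> U" "t \<in> U" "a = \<pi> s" "b = \<pi> t" by auto
    then have "\<phi> s = \<phi> t" using eq val by metis
    then show "a = b"
      using st chart_inj[OF c] U(1) by (metis inj_onD subsetD)
  qed
  from inv_into_f_f[OF this, of "\<pi> x"]
  show "inv_into (\<pi> ` U) (\<phi> \<circ> inv_into U \<pi>) (\<phi> x) = \<pi> x"
    using val[OF x] x by simp
  show "inv_into V \<phi> (\<phi> x) = x"
    using chart_inv[OF c] x U(1) by blast
  show "x \<in> carrier G"
    using x U(1) chart_subset[OF c] by (auto simp: topspace_carrier)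
qed

lemma quot_chart_image:
  assumes q: "quot_chart U V \<phi>"
  shows "(\<phi> \<circ> inv_into U \<pi>) ` (Q \<inter> \<pi> ` U) = \<phi> ` (U \<inter> {x \<in> carrier G. \<pi> x \<in> Q})"
proof -
  have "(\<phi> \<circ> inv_into U \<pi>) ` (Q \<inter> \<pi> ` U) = (\<phi> \<circ> inv_into U \<pi>) ` (\<pi> ` (U \<inter> {x \<in> carrier G. \<pi> x \<in> Q}))"
    using quot_chart_values(4)[OF q] by (intro arg_cong[where f = "image _"]) auto
  also have "\<dots> = \<phi> ` (U \<inter> {x \<in> carrier G. \<pi> x \<in> Q})"
    unfolding image_image by (intro image_cong refl quot_chart_values(1)[OF q]) auto
  finally show ?thesis .
qed

lemma quot_chart_open:
  assumes q: "quot_chart U V \<phi>" and W: "openin (mtop M) W"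
  shows "open (\<phi> ` (U \<inter> W))"
  using q W by (intro chart_open_image[of V \<phi>]) (auto simp: quot_chart_def)

lemma quot_chart_smooth_iff:
  assumes q: "quot_chart U V \<phi>" and W: "openin (mtop M) W"
  shows "smooth_on (\<phi> ` (U \<inter> W)) (f \<circ> inv_into (\<pi> ` U) (\<phi> \<circ> inv_into U \<pi>)) \<longleftrightarrow>
     smooth_on (\<phi> ` (U \<inter> W)) (f \<circ> \<pi> \<circ> inv_into V \<phi>)" (is "smooth_on ?S ?f \<longleftrightarrow> smooth_on ?S ?g")
proof -
  have "?f y = ?g y" if "y \<in> ?S" for y
    using that quot_chart_values(2,3)[OF q] by auto
  then show ?thesis
    using smooth_on_cong[OF _ quot_chart_open[OF assms], of ?f ?g]
      smooth_on_cong[OF _ quot_chart_open[OF assms], of ?g ?f] by auto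
qed

text \<open>A chart of the quotient is a chart of \<open>M\<close> read through a local inverse of
  the projection, so in coordinates \<open>f\<close> and \<open>f \<circ> \<pi>\<close> are the same
  function. Questions of smoothness on the quotient are answered on \<open>M\<close> by this
  equivalence.\<close>

lemma smooth_fun_quotient_iff:
  assumes Q: "openin (mtop N) Q"
  shows "smooth_fun N Q f \<longleftrightarrow> smooth_fun M {x \<in> carrier G. \<pi> x \<in> Q} (f \<circ> \<pi>)"
proof
  let ?Q = "{x \<in> carrier G. \<pi> x \<in> Q}"
  have oQ: "openin (mtop M) ?Q"
    by (rule proj_preimage_openin[OF Q])
  {
    assume f: "smooth_fun N Q f"
    show "smooth_fun M ?Q (f \<circ> \<pi>)"
    proof (rule smooth_funI[OF oQ])
      fix p assume p: "p \<in> ?Q"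
      then obtain U V \<phi> where q: "quot_chart U V \<phi>" and pU: "p \<in> U"
        using quot_chart_at by blast
      have "(\<pi> ` U, \<phi> \<circ> inv_into U \<pi>) \<in> atlas N"
        using q atlas_quotient by blast
      with f have "smooth_on ((\<phi> \<circ> inv_into U \<pi>) ` (Q \<inter> \<pi> ` U)) (f \<circ> inv_into (\<pi> ` U) (\<phi> \<circ> inv_into U \<pi>))"
        unfolding smooth_fun_def by blast
      then have "smooth_on (\<phi> ` (U \<inter> ?Q)) (f \<circ> \<pi> \<circ> inv_into V \<phi>)"
        unfolding quot_chart_image[OF q] quot_chart_smooth_iff[OF q oQ] .
      then show "\<exists>V \<phi> W. (V, \<phi>) \<in> atlas M \<and> openin (mtop M) W \<and> p \<in> W \<and> W \<subseteq> V \<and>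
          smooth_on (\<phi> ` W) (f \<circ> \<pi> \<circ> inv_into V \<phi>)"
        using q p pU oQ
        by (intro exI[of _ V] exI[of _ \<phi>] exI[of _ "U \<inter> ?Q"]) (auto simp: quot_chart_def)
    qed
  next
    assume f: "smooth_fun M ?Q (f \<circ> \<pi>)"
    show "smooth_fun N Q f"
      unfolding smooth_fun_def
    proof (intro ballI, clarify)
      fix T \<psi> assume "(T, \<psi>) \<in> atlas N"
      then obtain U V \<phi> where q: "quot_chart U V \<phi>" and T: "T = \<pi> ` U" "\<psi> = \<phi> \<circ> inv_into U \<pi>"
        unfolding atlas_quotient by blast
      have c: "(V, \<phi>) \<in> atlas M" "U \<subseteq> V" using q by (auto simp: quot_chart_def)
      have "smooth_on (\<phi> ` (U \<inter> ?Q)) (f \<circ> \<pi> \<circ> inv_into V \<phi>)"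
        by (rule smooth_on_subset[OF smooth_fun_chart[OF f c(1)]]) (use c(2) in blast)
      then show "smooth_on (\<psi> ` (Q \<inter> T)) (f \<circ> inv_into T \<psi>)"
        unfolding T quot_chart_image[OF q] quot_chart_smooth_iff[OF q oQ] .
    qed
  }
qed

lemma smooth_near_quotient:
  assumes p: "p \<in> carrier G" and f: "smooth_near N (\<pi> p) f"
  shows "smooth_near M p (f \<circ> \<pi>)"
proof -
  obtain Q where Q: "openin (mtop N) Q" "\<pi> p \<in> Q" "smooth_fun N Q f"
    using f unfolding smooth_near_def by blast
  show ?thesis
    by (rule smooth_nearI[OF proj_preimage_openin[OF Q(1)]])
      (use Q p smooth_fun_quotient_iff[OF Q(1)] in auto)
qed

section \<open>Tangent vectors and invariant fields on the quotient\<close>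

abbreviation "d\<pi> p u \<equiv> tangent_map N \<pi> p u"

text \<open>In corresponding charts the projection is the identity, so the components
  \<open>w\<close> do not change.\<close>

lemma quot_chart_tangent:
  assumes q: "quot_chart U V \<phi>" and x: "x \<in> U"
  shows "d\<pi> x (coord_derivation M V \<phi> x w) = coord_derivation N (\<pi> ` U) (\<phi> \<circ> inv_into U \<pi>) (\<pi> x) w"
proof
  fix f
  have c: "(V, \<phi>) \<in> atlas M" "x \<in> V" using q x by (auto simp: quot_chart_def)
  have xG: "x \<in> carrier G" by (rule quot_chart_values(4)[OF q x])
  show "d\<pi> x (coord_derivation M V \<phi> x w) f =
      coord_derivation N (\<pi> ` U) (\<phi> \<circ> inv_into U \<pi>) (\<pi> x) w f"
  proof (cases "smooth_near N (\<pi> x) f")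
    case True
    note near = smooth_near_quotient[OF xG True]
    have "frechet_derivative (f \<circ> \<pi> \<circ> inv_into V \<phi>) (at (\<phi> x)) =
        frechet_derivative (f \<circ> inv_into (\<pi> ` U) (\<phi> \<circ> inv_into U \<pi>)) (at (\<phi> x))"
    proof (rule frechet_derivative_transform_within_open[OF smooth_near_differentiable[OF c near]])
      show "open (\<phi> ` (U \<inter> carrier G))"
        by (rule quot_chart_open[OF q carrier_openin])
    qed (use x xG quot_chart_values(2,3)[OF q] in auto)
    then show ?thesis
      using True near by (simp add: tangent_map_def coord_derivation_def quot_chart_values(1)[OF q x, simplified])
  qed (simp add: tangent_map_def coord_derivation_def)
qed

lemma proj_tangent:
  assumes p: "p \<in> carrier G" and u: "u \<in> tangent_space M p"
  shows "d\<pi> p u \<in> tangent_space N (\<pi> p)"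
proof -
  obtain U V \<phi> where q: "quot_chart U V \<phi>" and x: "p \<in> U"
    using quot_chart_at[OF p] .
  have c: "(V, \<phi>) \<in> atlas M" "p \<in> V" using q x by (auto simp: quot_chart_def)
  obtain w where "u = coord_derivation M V \<phi> p w"
    using tangent_in_chart[OF u c] .
  then have "d\<pi> p u = coord_derivation N (\<pi> ` U) (\<phi> \<circ> inv_into U \<pi>) (\<pi> p) w"
    using quot_chart_tangent[OF q x] by simp
  moreover have "(\<pi> ` U, \<phi> \<circ> inv_into U \<pi>) \<in> atlas N"
    using q atlas_quotient by blast
  ultimately show ?thesis
    using x unfolding tangent_space_def by blast
qed

lemma quotient_tangentE:
  assumes "v \<in> tangent_space N c"
  obtains p u where "p \<in> carrier G" "\<pi> p = c" "u \<in> tangent_space M p" "v = d\<pi> p u"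
proof -
  obtain U V \<phi> w where q: "quot_chart U V \<phi>" and c: "c \<in> \<pi> ` U"
    and v: "v = coord_derivation N (\<pi> ` U) (\<phi> \<circ> inv_into U \<pi>) c w"
    using assms unfolding tangent_space_def atlas_quotient by blast
  then obtain p where p: "p \<in> U" "c = \<pi> p" by blast
  show ?thesis
  proof (rule that[of p "coord_derivation M V \<phi> p w"])
    show "coord_derivation M V \<phi> p w \<in> tangent_space M p"
      using q p by (intro coord_derivation_in_tangent_space) (auto simp: quot_chart_def)
  qed (use p v quot_chart_values(4)[OF q] quot_chart_tangent[OF q] in auto)
qed

text \<open>The lift of the coset is an arbitrary choice. Two lifts differ by left multiplication
  with an element of \<open>\<Gamma>\<close>, and for a left-invariant field the choice does not
  matter.\<close>

definition descend :: "('a \<Rightarrow> 'a tvec) \<Rightarrow> 'a set \<Rightarrow> 'a set tvec" where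
  "descend X c = (let p = SOME p. p \<in> carrier G \<and> \<pi> p = c in d\<pi> p (X p))"

lemma descend_proj:
  assumes X: "X \<in> lie_algebra G M" and p: "p \<in> carrier G"
  shows "descend X (\<pi> p) = d\<pi> p (X p)"
proof -
  define q where "q = (SOME q. q \<in> carrier G \<and> \<pi> q = \<pi> p)"
  have q: "q \<in> carrier G" "\<pi> q = \<pi> p"
    unfolding q_def using someI[of "\<lambda>q. q \<in> carrier G \<and> \<pi> q = \<pi> p" p] p by auto
  define \<gamma> where "\<gamma> = q \<otimes> inv p"
  have g: "\<gamma> \<in> \<Gamma>" "\<gamma> \<in> carrier G"
    using q p proj_eq_iff[of q p] by (auto simp: \<gamma>_def)
  have "q = \<gamma> \<otimes> p" using q p by (simp add: \<gamma>_def m_assoc)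
  then have Xq: "X q = dL \<gamma> p (X p)"
    using lie_algebra_translate[OF X g(2) p] by simp
  have "d\<pi> q (X q) f = d\<pi> p (X p) f" for f
  proof (cases "smooth_near N (\<pi> p) f")
    case True
    then have "smooth_near M (\<gamma> \<otimes> p) (f \<circ> \<pi>)"
      using smooth_near_quotient[OF q(1)] q(2) \<open>q = \<gamma> \<otimes> p\<close> by simp
    \<comment> \<open>Functions pulled back from the quotient are invariant under left
      multiplication by \<open>\<gamma>\<close>; with the left-invariance of \<open>X\<close> both
      lifts give the same value.\<close>
    moreover have "X p (f \<circ> \<pi> \<circ> (\<otimes>) \<gamma>) = X p (f \<circ> \<pi>)"
      by (rule tangent_cong[OF lie_algebra_tangent[OF X p] carrier_openin p])
        (simp add: proj_translate[OF g(1)])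
    ultimately show ?thesis
      using True q(2) by (simp add: tangent_map_def Xq)
  qed (simp add: tangent_map_def q)
  then show ?thesis
    by (simp add: descend_def q_def[symmetric] Let_def ext)
qed

lemma descend_vector_field:
  assumes X: "X \<in> lie_algebra G M"
  shows "vector_field N (topspace (mtop N)) (descend X)"
  unfolding vector_field_def
proof (intro conjI ballI allI impI)
  fix c assume "c \<in> topspace (mtop N)"
  then obtain p where "p \<in> carrier G" "c = \<pi> p" by (auto simp: topspace_quotient)
  then show "descend X c \<in> tangent_space N c"
    using proj_tangent lie_algebra_tangent[OF X] descend_proj[OF X] by simp
next
  fix Q f assume "openin (mtop N) Q \<and> Q \<subseteq> topspace (mtop N) \<and> smooth_fun N Q f"
  then have Q: "openin (mtop N) Q" "smooth_fun N Q f" by auto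
  let ?Q = "{x \<in> carrier G. \<pi> x \<in> Q}"
  have oQ: "openin (mtop M) ?Q"
    by (rule proj_preimage_openin[OF Q(1)])
  have "smooth_fun M ?Q (f \<circ> \<pi>)"
    using Q smooth_fun_quotient_iff by blast
  then have "smooth_fun M ?Q (\<lambda>p. X p (f \<circ> \<pi>))"
    using vector_field_smooth[OF lie_algebra_field[OF X] oQ] by blast
  then have "smooth_fun M ?Q ((\<lambda>c. descend X c f) \<circ> \<pi>)"
  proof (rule smooth_fun_cong[OF _ oQ])
    fix p assume p: "p \<in> ?Q"
    then have "smooth_near N (\<pi> p) f" using Q unfolding smooth_near_def by blast
    then show "X p (f \<circ> \<pi>) = ((\<lambda>c. descend X c f) \<circ> \<pi>) p"
      using p by (simp add: descend_proj[OF X] tangent_map_def)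
  qed
  then show "smooth_fun N Q (\<lambda>c. descend X c f)"
    using smooth_fun_quotient_iff[OF Q(1)] by blast
qed

text \<open>The projection relates \<open>X\<close> to \<open>descend X\<close>, so this is
  \<open>bracket_related\<close> once more.\<close>

lemma descend_bracket:
  assumes X: "X \<in> lie_algebra G M" and Y: "Y \<in> lie_algebra G M" and p: "p \<in> carrier G"
  shows "bracket N (descend X) (descend Y) (\<pi> p) = descend (bracket M X Y) (\<pi> p)"
  unfolding descend_proj[OF lie_algebra_bracket[OF X Y] p]
proof (rule bracket_related)
  fix Q f assume "openin (mtop N) Q" "smooth_fun N Q f"
  then show "openin (mtop M) {x \<in> topspace (mtop M). \<pi> x \<in> Q} \<and>
      smooth_fun M {x \<in> topspace (mtop M). \<pi> x \<in> Q} (f \<circ> \<pi>)"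
    using smooth_fun_quotient_iff proj_preimage_openin by (simp add: topspace_carrier)
qed (use X Y p descend_vector_field descend_proj lie_algebra_field in \<open>auto simp: topspace_carrier\<close>)

lemma descend_lincomb:
  assumes X: "X \<in> lie_algebra G M" and Y: "Y \<in> lie_algebra G M" and p: "p \<in> carrier G"
  shows "descend (\<lambda>p. lincomb a (X p) b (Y p)) (\<pi> p) = lincomb a (descend X (\<pi> p)) b (descend Y (\<pi> p))"
  by (simp add: descend_proj lie_algebra_lincomb X Y p tangent_map_lincomb)

text \<open>Removes the terms of \<open>ext_d1\<close> and \<open>ext_d2\<close> that differentiate
  a function: on invariant fields these functions turn out to be constant, and only bracket terms
  survive.\<close>

lemma descend_const:
  assumes X: "X \<in> lie_algebra G M" and p: "p \<in> carrier G" and F: "\<And>q. q \<in> carrier G \<Longrightarrow> F (\<pi> q) = k"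
  shows "descend X (\<pi> p) F = 0"
proof -
  have "X p (F \<circ> \<pi>) = 0"
    by (rule tangent_const[OF lie_algebra_tangent[OF X p] carrier_openin p]) (simp add: F)
  then show ?thesis
    by (simp add: descend_proj[OF X p] tangent_map_def)
qed

end

section \<open>Hyperhermitian structures on nilpotent Lie algebras\<close>

text \<open>
  The Lie algebra is given by a carrier set with an explicit operation \<open>lc\<close> for linear
  combinations, because fields of derivations do not form an instance of a vector space class.
\<close>

locale hyperhermitian_algebra =
  fixes S :: "'v set" and lc :: "real \<Rightarrow> 'v \<Rightarrow> real \<Rightarrow> 'v \<Rightarrow> 'v" and zero :: 'v
    and br :: "'v \<Rightarrow> 'v \<Rightarrow> 'v" and ip :: "'v \<Rightarrow> 'v \<Rightarrow> real"
    and I J K :: "'v \<Rightarrow> 'v"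
  assumes lc_in: "x \<in> S \<Longrightarrow> y \<in> S \<Longrightarrow> lc a x b y \<in> S"
    and br_in: "x \<in> S \<Longrightarrow> y \<in> S \<Longrightarrow> br x y \<in> S"
    and I_in: "x \<in> S \<Longrightarrow> I x \<in> S"
    and J_in: "x \<in> S \<Longrightarrow> J x \<in> S"
    and K_in: "x \<in> S \<Longrightarrow> K x \<in> S"
    and lc_zero: "x \<in> S \<Longrightarrow> lc 0 x 0 x = zero"
    and ip_sym: "x \<in> S \<Longrightarrow> y \<in> S \<Longrightarrow> ip x y = ip y x"
    and ip_lc: "x \<in> S \<Longrightarrow> y \<in> S \<Longrightarrow> z \<in> S \<Longrightarrow> ip (lc a x b y) z = a * ip x z + b * ip y z"
    and ip_pos: "x \<in> S \<Longrightarrow> x \<noteq> zero \<Longrightarrow> ip x x > 0"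
    and herm: "A \<in> {I, J, K} \<Longrightarrow> x \<in> S \<Longrightarrow> y \<in> S \<Longrightarrow> ip (A x) (A y) = ip x y"
    and square: "A \<in> {I, J, K} \<Longrightarrow> x \<in> S \<Longrightarrow> y \<in> S \<Longrightarrow> ip (A (A x)) y = - ip x y"
    and quaternion: "x \<in> S \<Longrightarrow> y \<in> S \<Longrightarrow> ip (I (J x)) y = ip (K x) y"
begin

lemma str_in: "A \<in> {I, J, K} \<Longrightarrow> x \<in> S \<Longrightarrow> A x \<in> S"
  using I_in J_in K_in by auto

text \<open>The Chevalley-Eilenberg differential of the two-form \<open>ip (A x) y\<close>, that is,
  the Koszul formula \<open>ext_d2\<close> without its derivative terms.\<close>

definition d_omega :: "('v \<Rightarrow> 'v) \<Rightarrow> 'v \<Rightarrow> 'v \<Rightarrow> 'v \<Rightarrow> real" where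
  "d_omega A x y z = - ip (A (br x y)) z + ip (A (br x z)) y - ip (A (br y z)) x"

definition lee :: "('v \<Rightarrow> real) \<Rightarrow> bool" where
  "lee t \<longleftrightarrow> (\<forall>A\<in>{I, J, K}. \<forall>x\<in>S. \<forall>y\<in>S. \<forall>z\<in>S.
     d_omega A x y z = t x * ip (A y) z - t y * ip (A x) z + t z * ip (A x) y)"

text \<open>The locale gives the identities for \<open>A\<close> only after pairing with
  \<open>ip\<close>. Evaluating \<open>ip (A (A x)) (A y)\<close> once by \<open>herm\<close> and
  once by \<open>square\<close> produces the sign.\<close>

lemma skew:
  assumes "A \<in> {I, J, K}" "x \<in> S" "y \<in> S"
  shows "ip (A x) y = - ip x (A y)"
  using herm[OF assms(1) str_in[OF assms(1,2)] assms(3)] square[OF assms(1,2) str_in[OF assms(1,3)]]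
  by simp

lemma skew_self:
  assumes "A \<in> {I, J, K}" "x \<in> S"
  shows "ip x (A x) = 0"
  using skew[OF assms(1,2,2)] ip_sym[OF assms(2) str_in[OF assms]] by simp

lemma ip_zero: "x \<in> S \<Longrightarrow> ip zero x = 0"
  using ip_lc[of x x x 0 0] lc_zero[of x] by simp

lemma zero_in: "x \<in> S \<Longrightarrow> zero \<in> S"
  using lc_in[of x x 0 0] lc_zero[of x] by simp

text \<open>Linearity of \<open>A\<close> is not among the locale assumptions, so \<open>A\<close>
  is moved to the other argument.\<close>

lemma str_zero:
  assumes "A \<in> {I, J, K}" "x \<in> S"
  shows "ip (A zero) x = 0"
  using skew[OF assms(1) zero_in[OF assms(2)] assms(2)] ip_zero[OF str_in[OF assms]] by simp

text \<open>Since I J x = K x, the value omega_I(Jx, Kx) is |Kx|^2 = |x|^2, while omega_I(x, Kx) and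
  omega_I(x, Jx) vanish by orthogonality of the quaternionic frame. The right-hand side does not
  involve \<open>t\<close>, so bracket and metric determine \<open>t x\<close> for nonzero
  \<open>x\<close>.\<close>

lemma lee_formula:
  assumes t: "lee t" and x: "x \<in> S"
  shows "t x * ip x x = d_omega I x (J x) (K x)"
proof -
  have S: "I x \<in> S" "J x \<in> S" "K x \<in> S" "I (J x) \<in> S"
    using str_in x by auto
  have "d_omega I x (J x) (K x) =
      t x * ip (I (J x)) (K x) - t (J x) * ip (I x) (K x) + t (K x) * ip (I x) (J x)"
    using t x S unfolding lee_def by blast
  moreover have "ip (I (J x)) (K x) = ip x x"
    using quaternion[OF x S(3)] herm[of K x x] x by simp
  moreover have "ip (I x) (K x) = 0"
    using quaternion[OF x S(1)] ip_sym[OF S(1,3)] ip_sym[OF S(1,4)] herm[of I x "J x"] skew_self[of J x] x S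
    by simp
  moreover have "ip (I x) (J x) = 0"
    using skew[of I x "J x"] ip_sym[OF x S(4)] ip_sym[OF x S(3)] quaternion[OF x x] skew_self[of K x] x S
    by simp
  ultimately show ?thesis by simp
qed

lemma br_iterate_in: "T \<in> S \<Longrightarrow> y \<in> S \<Longrightarrow> (br T ^^ n) y \<in> S"
  by (induction n) (auto intro: br_in)

text \<open>
  For a central \<open>z\<close> in the kernel of the Lee form \<open>t\<close>, the equation \<open>d\<omega> = t \<and> \<omega>\<close> says that on that
  kernel the functional \<open>ip _ (A z)\<close> is an eigenvector of the transpose of \<open>ad T\<close> with eigenvalue
  \<open>- 1\<close>. Since \<open>ad T\<close> is nilpotent, the functional vanishes there.
\<close>

lemma central_functional:
  assumes t: "lee t" and t_lc: "\<And>a b x y. x \<in> S \<Longrightarrow> y \<in> S \<Longrightarrow> t (lc a x b y) = a * t x + b * t y"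
    and t_br: "\<And>x y. x \<in> S \<Longrightarrow> y \<in> S \<Longrightarrow> t (br x y) = 0"
    and T: "T \<in> S" "t T = 1" and z: "z \<in> S" "t z = 0"
    and central: "\<And>x. x \<in> S \<Longrightarrow> br x z = zero"
    and nil: "\<And>y. y \<in> S \<Longrightarrow> \<exists>n. (br T ^^ n) y = zero"
    and A: "A \<in> {I, J, K}" and y: "y \<in> S"
  shows "ip y (A z) = t y * ip T (A z)"
proof -
  note Az = str_in[OF A z(1)]
  \<comment> \<open>The Lee equation at (x, y, z): centrality removes the brackets with
    \<open>z\<close>, \<open>t z = 0\<close> removes the last term, and \<open>skew\<close> moves
    \<open>A\<close> onto \<open>z\<close>.\<close>
  have step: "ip (br x y) (A z) = - t x * ip y (A z) + t y * ip x (A z)" if x: "x \<in> S" and y: "y \<in> S" for x y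
  proof -
    have "d_omega A x y z = t x * ip (A y) z - t y * ip (A x) z + t z * ip (A x) y"
      using t A x y z unfolding lee_def by blast
    then show ?thesis
      using skew[OF A _ z(1)] x y br_in[OF x y] central str_zero[OF A] z(2)
      by (simp add: d_omega_def)
  qed
  have ker: "ip y (A z) = 0" if y: "y \<in> S" "t y = 0" for y
  proof -
    \<comment> \<open>Brackets lie in the kernel of \<open>t\<close>, so the iterates stay there;
      the second term of \<open>step\<close> is then 0 and each application of \<open>br T\<close>
      contributes a factor -1.\<close>
    have it: "t ((br T ^^ n) y) = 0 \<and> ip ((br T ^^ n) y) (A z) = (- 1) ^ n * ip y (A z)" for n
    proof (induction n)
      case (Suc n)
      then show ?case
        using step[OF T(1) br_iterate_in[OF T(1) y(1), of n]] t_br[OF T(1) br_iterate_in[OF T(1) y(1), of n]] T(2)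
        by simp
    qed (use y in simp)
    obtain n where "(br T ^^ n) y = zero" using nil[OF y(1)] by blast
    then have "(- 1) ^ n * ip y (A z) = 0"
      using it[of n] ip_zero[OF Az] by simp
    then show ?thesis by simp
  qed
  \<comment> \<open>The projection of \<open>y\<close> along \<open>T\<close> to the kernel of
    \<open>t\<close>.\<close>
  have "t (lc 1 y (- t y) T) = 0"
    using t_lc[OF y T(1)] T(2) by simp
  from ker[OF lc_in[OF y T(1)] this] show ?thesis
    using ip_lc[OF y T(1) Az] by simp
qed

lemma no_central_in_kernel:
  assumes t: "lee t" and t_lc: "\<And>a b x y. x \<in> S \<Longrightarrow> y \<in> S \<Longrightarrow> t (lc a x b y) = a * t x + b * t y"
    and t_br: "\<And>x y. x \<in> S \<Longrightarrow> y \<in> S \<Longrightarrow> t (br x y) = 0"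
    and T: "T \<in> S" "t T = 1" and z: "z \<in> S" "t z = 0"
    and central: "\<And>x. x \<in> S \<Longrightarrow> br x z = zero"
    and nil: "\<And>y. y \<in> S \<Longrightarrow> \<exists>n. (br T ^^ n) y = zero"
  shows "z = zero"
proof (rule ccontr)
  assume "z \<noteq> zero"
  then have pos: "ip z z > 0" using ip_pos z by blast
  note alpha = central_functional[OF assms]
  have S: "I z \<in> S" "J z \<in> S" "K z \<in> S" "I (J z) \<in> S" using str_in z by auto
  have orth: "ip (J z) (I z) = 0"
    using skew[of I z "J z"] ip_sym[OF S(1,2)] ip_sym[OF z(1) S(4)] ip_sym[OF z(1) S(3)]
      quaternion[OF z(1) z(1)] skew_self[of K z] z S by simp
  \<comment> \<open>The first equation forces \<open>ip T (I z)\<close> to be nonzero and the second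
    forces \<open>t (J z)\<close> to be nonzero, whereas orthogonality of \<open>J z\<close> and
    \<open>I z\<close> makes their product 0.\<close>
  have "ip z z = t (I z) * ip T (I z)" "ip z z = t (J z) * ip T (J z)"
    using alpha[of I "I z"] alpha[of J "J z"] herm[of I z z] herm[of J z z] z S by auto
  moreover have "t (J z) * ip T (I z) = 0"
    using alpha[of I "J z"] orth S by simp
  ultimately show False using pos by auto
qed

end

section \<open>The lower central series of a nilpotent algebra\<close>

context lie_grp
begin

text \<open>The index \<open>m\<close> is the last one with a nonzero term. Centrality is given for
  all \<open>W\<close> in that term rather than for \<open>Z\<close> alone: when
  \<open>m = 0\<close> it says that the algebra is abelian.\<close>

lemma nilpotent_central:
  assumes nil: "lower_central G M k \<subseteq> {\<lambda>_ _. 0}"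
    and X: "X \<in> lie_algebra G M" "X \<noteq> (\<lambda>_ _. 0)"
  obtains m Z where "Z \<in> lower_central G M m" "Z \<noteq> (\<lambda>_ _. 0)"
    "\<And>Y W. Y \<in> lie_algebra G M \<Longrightarrow> W \<in> lower_central G M m \<Longrightarrow> bracket M Y W = (\<lambda>_ _. 0)"
proof -
  define n where "n = (LEAST n. lower_central G M n \<subseteq> {\<lambda>_ _. 0})"
  have n: "lower_central G M n \<subseteq> {\<lambda>_ _. 0}"
    unfolding n_def by (rule LeastI[of "\<lambda>n. lower_central G M n \<subseteq> {\<lambda>_ _. 0}", OF nil])
  then have "n \<noteq> 0" using X by (intro notI) auto
  then obtain m where m: "n = Suc m" using not0_implies_Suc by blast
  then have "\<not> lower_central G M m \<subseteq> {\<lambda>_ _. 0}"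
    using not_less_Least[of m "\<lambda>n. lower_central G M n \<subseteq> {\<lambda>_ _. 0}"] by (simp add: n_def)
  then obtain Z where "Z \<in> lower_central G M m" "Z \<noteq> (\<lambda>_ _. 0)" by blast
  then show ?thesis
    using that[of Z m] bracket_lower_central n m by blast
qed

lemma bracket_iterate:
  assumes nil: "lower_central G M k \<subseteq> {\<lambda>_ _. 0}"
    and T: "T \<in> lie_algebra G M" and Y: "Y \<in> lie_algebra G M"
  shows "(bracket M T ^^ k) Y = (\<lambda>_ _. 0)"
proof -
  have "(bracket M T ^^ n) Y \<in> lower_central G M n" for n
  proof (induction n)
    case (Suc n)
    then show ?case using bracket_lower_central[OF T] by simp
  qed (use Y in simp)
  then show ?thesis using nil by blast
qed

end

section \<open>Invariant structures on the quotient\<close>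

context lie_quotient
begin

abbreviation "base \<equiv> \<pi> \<one>"

lemma left_invariant_metric_on_algebra:
  assumes "left_invariant_metric G M \<Gamma> g"
  obtains ip where
    "\<And>X Y p. X \<in> lie_algebra G M \<Longrightarrow> Y \<in> lie_algebra G M \<Longrightarrow> p \<in> carrier G \<Longrightarrow>
       g (\<pi> p) (descend X (\<pi> p)) (descend Y (\<pi> p)) = ip X Y"
    "\<And>X. X \<in> lie_algebra G M \<Longrightarrow> X \<noteq> (\<lambda>_ _. 0) \<Longrightarrow> ip X X > 0"
proof -
  obtain h where h: "riemannian_metric M (carrier G) h"
    and inv: "\<And>p u v a. p \<in> carrier G \<Longrightarrow> u \<in> tangent_space M p \<Longrightarrow> v \<in> tangent_space M p \<Longrightarrow>
      a \<in> carrier G \<Longrightarrow> h (a \<otimes> p) (dL a p u) (dL a p v) = h p u v"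
    and g: "\<And>p u v. p \<in> carrier G \<Longrightarrow> u \<in> tangent_space M p \<Longrightarrow> v \<in> tangent_space M p \<Longrightarrow>
      g (\<pi> p) (d\<pi> p u) (d\<pi> p v) = h p u v"
    using assms unfolding left_invariant_metric_def Let_def by blast
  show ?thesis
  proof (rule that[of "\<lambda>X Y. h \<one> (X \<one>) (Y \<one>)"])
    fix X Y p assume X: "X \<in> lie_algebra G M" and Y: "Y \<in> lie_algebra G M" and p: "p \<in> carrier G"
    show "g (\<pi> p) (descend X (\<pi> p)) (descend Y (\<pi> p)) = h \<one> (X \<one>) (Y \<one>)"
      using inv[OF one_closed lie_algebra_tangent[OF X] lie_algebra_tangent[OF Y] p]
        lie_algebra_translate[OF X p one_closed] lie_algebra_translate[OF Y p one_closed]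
        g[OF p lie_algebra_tangent[OF X p] lie_algebra_tangent[OF Y p]] p
      by (simp add: descend_proj[OF X p] descend_proj[OF Y p])
  next
    fix X assume X: "X \<in> lie_algebra G M" "X \<noteq> (\<lambda>_ _. 0)"
    \<comment> \<open>A left-invariant field that is zero at the identity is zero on
      \<open>G\<close> by translation and off \<open>G\<close> by the normalisation.\<close>
    have "X \<one> \<noteq> (\<lambda>_. 0)"
    proof
      assume 0: "X \<one> = (\<lambda>_. 0)"
      have "X p = (\<lambda>_. 0)" for p
      proof (cases "p \<in> carrier G")
        case True
        then show ?thesis
          using lie_algebra_translate[OF X(1) True one_closed] 0 by (simp add: tangent_map_def)
      qed (rule lie_algebra_off[OF X(1)])
      then show False using X(2) by auto
    qed
    then show "h \<one> (X \<one>) (X \<one>) > 0"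
      using h lie_algebra_tangent[OF X(1)] unfolding riemannian_metric_def by blast
  qed
qed

lemma left_invariant_structure_on_algebra:
  assumes "left_invariant_complex_structure G M \<Gamma> A"
  obtains L where "\<And>X. X \<in> lie_algebra G M \<Longrightarrow> L X \<in> lie_algebra G M"
    "\<And>X p. X \<in> lie_algebra G M \<Longrightarrow> p \<in> carrier G \<Longrightarrow> descend (L X) (\<pi> p) = A (\<pi> p) (descend X (\<pi> p))"
proof -
  obtain B where B: "complex_structure M (carrier G) B"
    and inv: "\<And>p u a. p \<in> carrier G \<Longrightarrow> u \<in> tangent_space M p \<Longrightarrow> a \<in> carrier G \<Longrightarrow>
      B (a \<otimes> p) (dL a p u) = dL a p (B p u)"
    and A: "\<And>p u. p \<in> carrier G \<Longrightarrow> u \<in> tangent_space M p \<Longrightarrow> A (\<pi> p) (d\<pi> p u) = d\<pi> p (B p u)"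
    using assms unfolding left_invariant_complex_structure_def Let_def by blast
  define L where "L X p = (if p \<in> carrier G then B p (X p) else (\<lambda>_. 0))" for X p
  have L: "L X \<in> lie_algebra G M" if X: "X \<in> lie_algebra G M" for X
  proof (rule lie_algebraI)
    have "vector_field M (carrier G) (\<lambda>p. B p (X p))"
      using B lie_algebra_field[OF X] carrier_openin
      unfolding complex_structure_def almost_complex_structure_def by blast
    then show "vector_field M (carrier G) (L X)"
      by (rule vector_field_cong) (simp add: L_def)
  qed (use X inv lie_algebra_tangent[OF X] lie_algebra_translate[OF X] in \<open>auto simp: L_def\<close>)
  show ?thesis
  proof (rule that[of L])
    fix X p assume X: "X \<in> lie_algebra G M" and p: "p \<in> carrier G"
    show "descend (L X) (\<pi> p) = A (\<pi> p) (descend X (\<pi> p))"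
      using A[OF p lie_algebra_tangent[OF X p]] p
      by (simp add: descend_proj[OF X p] descend_proj[OF L[OF X] p]) (simp add: L_def)
  qed (rule L)
qed

lemma zero_smooth_fun_quotient: "smooth_fun N (topspace (mtop N)) (\<lambda>_. 0)"
  using smooth_fun_quotient_iff[OF openin_topspace] smooth_fun_const by (simp add: comp_def)

text \<open>The constant 0 would be a primitive if the form vanished on all tangent vectors. A
  vector where it does not vanish is lifted to \<open>M\<close> and extended to a left-invariant
  field.\<close>

lemma not_exact_nonzero:
  assumes "\<not> exact_one_form N (topspace (mtop N)) \<theta>"
  obtains X p where "X \<in> lie_algebra G M" "p \<in> carrier G" "\<theta> (\<pi> p) (descend X (\<pi> p)) \<noteq> 0"
proof -
  obtain c v where v: "v \<in> tangent_space N c" "\<theta> c v \<noteq> v (\<lambda>_. 0)"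
    using assms zero_smooth_fun_quotient unfolding exact_one_form_def by blast
  obtain p u where p: "p \<in> carrier G" "\<pi> p = c" and u: "u \<in> tangent_space M p" "v = d\<pi> p u"
    using quotient_tangentE[OF v(1)] .
  obtain X where X: "X \<in> lie_algebra G M" "X p = u"
    using lie_algebra_through[OF p(1) u(1)] .
  have "u ((\<lambda>_. 0) \<circ> \<pi>) = 0"
    by (rule tangent_const[OF u(1) carrier_openin p(1)]) simp
  then have "v (\<lambda>_. 0) = 0"
    by (simp add: u(2) tangent_map_def)
  then show ?thesis
    using that[OF X(1) p(1)] descend_proj[OF X(1) p(1)] v p u X by simp
qed

lemma left_invariant_lchK_exact:
  assumes nil: "lower_central G M k \<subseteq> {\<lambda>_ _. 0}"
    and g: "left_invariant_metric G M \<Gamma> g"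
    and str: "\<And>A. A \<in> {I, J, K} \<Longrightarrow> left_invariant_complex_structure G M \<Gamma> A"
    and hh: "hyperhermitian N (topspace (mtop N)) g I J K"
    and lee: "Lee_form N g I J K \<theta>"
  shows "exact_one_form N (topspace (mtop N)) \<theta>"
proof (rule ccontr)
  assume "\<not> ?thesis"
  then obtain X0 p0 where X0: "X0 \<in> lie_algebra G M" "p0 \<in> carrier G" "\<theta> (\<pi> p0) (descend X0 (\<pi> p0)) \<noteq> 0"
    using not_exact_nonzero by blast
  obtain ip where ip: "\<And>X Y p. X \<in> lie_algebra G M \<Longrightarrow> Y \<in> lie_algebra G M \<Longrightarrow> p \<in> carrier G \<Longrightarrow>
       g (\<pi> p) (descend X (\<pi> p)) (descend Y (\<pi> p)) = ip X Y"
    and ip_pos: "\<And>X. X \<in> lie_algebra G M \<Longrightarrow> X \<noteq> (\<lambda>_ _. 0) \<Longrightarrow> ip X X > 0"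
    using left_invariant_metric_on_algebra[OF g] by metis
  have "\<exists>L. (\<forall>X\<in>lie_algebra G M. L X \<in> lie_algebra G M) \<and> (\<forall>X\<in>lie_algebra G M. \<forall>p\<in>carrier G.
      descend (L X) (\<pi> p) = A (\<pi> p) (descend X (\<pi> p)))" if "A \<in> {I, J, K}" for A
    using left_invariant_structure_on_algebra[OF str[OF that]] by metis
  then obtain L where L_in: "\<And>A X. A \<in> {I, J, K} \<Longrightarrow> X \<in> lie_algebra G M \<Longrightarrow> L A X \<in> lie_algebra G M"
    and L: "\<And>A X p. A \<in> {I, J, K} \<Longrightarrow> X \<in> lie_algebra G M \<Longrightarrow> p \<in> carrier G \<Longrightarrow>
      descend (L A X) (\<pi> p) = A (\<pi> p) (descend X (\<pi> p))"
    by metis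
  have tan: "descend X (\<pi> p) \<in> tangent_space N (\<pi> p)" if "X \<in> lie_algebra G M" "p \<in> carrier G" for X p
    using descend_vector_field[OF that(1)] proj_in_topspace[OF that(2)] unfolding vector_field_def by blast
  let ?lc = "\<lambda>a X b Y p. lincomb a (X p) b (Y p)"
  have metric: "riemannian_metric N (topspace (mtop N)) g"
    and herm: "\<And>A. A \<in> {I, J, K} \<Longrightarrow> hermitian_wrt N (topspace (mtop N)) g A"
    and cplx: "\<And>A. A \<in> {I, J, K} \<Longrightarrow> almost_complex_structure N (topspace (mtop N)) A"
    and quat: "\<And>c u. c \<in> topspace (mtop N) \<Longrightarrow> u \<in> tangent_space N c \<Longrightarrow> I c (J c u) = K c u"
    using hh unfolding hyperhermitian_def complex_structure_def by blast+
  note base = proj_in_topspace[OF one_closed]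
  have base_lin: "g base (lincomb a u b v) w = a * g base u w + b * g base v w"
    if "u \<in> tangent_space N base" "v \<in> tangent_space N base" "w \<in> tangent_space N base" for a b u v w
    using metric base that unfolding riemannian_metric_def by blast
  \<comment> \<open>The metric and quaternionic identities are checked at the base coset, where
    \<open>ip\<close> is \<open>g\<close> on descended fields.\<close>
  interpret alg: hyperhermitian_algebra "lie_algebra G M" ?lc "\<lambda>_ _. 0" "bracket M" ip "L I" "L J" "L K"
  proof unfold_locales
    fix X Y Z :: "'a \<Rightarrow> 'a tvec" and a b
    assume X: "X \<in> lie_algebra G M" and Y: "Y \<in> lie_algebra G M"
    show "?lc a X b Y \<in> lie_algebra G M" by (rule lie_algebra_lincomb[OF X Y])
    show "bracket M X Y \<in> lie_algebra G M" by (rule lie_algebra_bracket[OF X Y])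
    show "ip X Y = ip Y X"
      using metric base tan[OF X one_closed] tan[OF Y one_closed] ip[OF X Y one_closed] ip[OF Y X one_closed]
      unfolding riemannian_metric_def by metis
    show "ip (L I (L J X)) Y = ip (L K X) Y"
      using quat[OF base tan[OF X one_closed]] ip[OF _ Y one_closed] L_in L X one_closed
      by (metis insert_iff)
    fix A assume "A \<in> {L I, L J, L K}"
    then obtain A' where A': "A' \<in> {I, J, K}" "A = L A'" by blast
    show "ip (A X) (A Y) = ip X Y"
    proof -
      have "g base (A' base (descend X base)) (A' base (descend Y base)) = g base (descend X base) (descend Y base)"
        using herm[OF A'(1)] base tan[OF X one_closed] tan[OF Y one_closed] unfolding hermitian_wrt_def by blast
      then show ?thesis
        using ip[OF L_in[OF A'(1) X] L_in[OF A'(1) Y] one_closed] ip[OF X Y one_closed]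
          L[OF A'(1) X one_closed] L[OF A'(1) Y one_closed] by (simp add: A'(2))
    qed
    show "ip (A (A X)) Y = - ip X Y"
    proof -
      have "A' base (A' base (descend X base)) = (\<lambda>f. - descend X base f)"
        using cplx[OF A'(1)] base tan[OF X one_closed] unfolding almost_complex_structure_def by blast
      \<comment> \<open>Negation is written as a linear combination since linearity of the metric is
        stated for \<open>lincomb\<close>.\<close>
      also have "\<dots> = lincomb (- 1) (descend X base) 0 (descend X base)"
        by (simp add: lincomb_def)
      finally show ?thesis
        using base_lin[OF tan[OF X one_closed] tan[OF X one_closed] tan[OF Y one_closed], of "- 1" 0]
          ip[OF L_in[OF A'(1) L_in[OF A'(1) X]] Y one_closed] ip[OF X Y one_closed]
          L[OF A'(1) X one_closed] L[OF A'(1) L_in[OF A'(1) X] one_closed] by (simp add: A'(2))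
    qed
  next
    fix X assume X: "X \<in> lie_algebra G M"
    show "L I X \<in> lie_algebra G M" by (rule L_in[OF _ X]) simp
    show "L J X \<in> lie_algebra G M" by (rule L_in[OF _ X]) simp
    show "L K X \<in> lie_algebra G M" by (rule L_in[OF _ X]) simp
  next
    fix X Y Z :: "'a \<Rightarrow> 'a tvec" and a b
    assume X: "X \<in> lie_algebra G M" and Y: "Y \<in> lie_algebra G M" and Z: "Z \<in> lie_algebra G M"
    show "ip (?lc a X b Y) Z = a * ip X Z + b * ip Y Z"
      using base_lin[OF tan[OF X one_closed] tan[OF Y one_closed] tan[OF Z one_closed]]
        ip[OF lie_algebra_lincomb[OF X Y] Z one_closed] ip[OF X Z one_closed] ip[OF Y Z one_closed]
        descend_lincomb[OF X Y one_closed] by simp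
  qed (auto simp: lincomb_def ip_pos)
  \<comment> \<open>The point \<open>p\<close> stays a parameter until \<open>t_const\<close> shows
    that the value does not depend on it.\<close>
  define t where "t p X = \<theta> (\<pi> p) (descend X (\<pi> p))" for p X
  have theta_lin: "\<And>c u v a b. c \<in> topspace (mtop N) \<Longrightarrow> u \<in> tangent_space N c \<Longrightarrow>
      v \<in> tangent_space N c \<Longrightarrow> \<theta> c (lincomb a u b v) = a * \<theta> c u + b * \<theta> c v"
    and closed: "\<And>X Y c. vector_field N (topspace (mtop N)) X \<Longrightarrow> vector_field N (topspace (mtop N)) Y \<Longrightarrow>
      c \<in> topspace (mtop N) \<Longrightarrow> ext_d1 N \<theta> X Y c = 0"
    using lee unfolding Lee_form_def closed_one_form_def one_form_def by blast+
  have t_lc: "t p (?lc a X b Y) = a * t p X + b * t p Y"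
    if "X \<in> lie_algebra G M" "Y \<in> lie_algebra G M" "p \<in> carrier G" for p a b X Y
    using theta_lin[OF proj_in_topspace[OF that(3)] tan[OF that(1,3)] tan[OF that(2,3)]]
    by (simp add: t_def descend_lincomb[OF that])
  have omega: "fundamental_form g A (\<pi> p) (descend X (\<pi> p)) (descend Y (\<pi> p)) = ip (L A X) Y"
    if "A \<in> {I, J, K}" "X \<in> lie_algebra G M" "Y \<in> lie_algebra G M" "p \<in> carrier G" for A X Y p
    using that by (simp add: fundamental_form_def L[symmetric] ip L_in)
  have t_lee: "alg.lee (t p)" if p: "p \<in> carrier G" for p
    unfolding alg.lee_def
  proof (intro ballI)
    fix A' X Y Z
    assume "A' \<in> {L I, L J, L K}"
      and X: "X \<in> lie_algebra G M" and Y: "Y \<in> lie_algebra G M" and Z: "Z \<in> lie_algebra G M"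
    then obtain A where A: "A \<in> {I, J, K}" "A' = L A" by blast
    have "ext_d2_equals N (topspace (mtop N)) (fundamental_form g A) (wedge12 \<theta> (fundamental_form g A))"
      using lee A(1) unfolding Lee_form_def by blast
    then have "ext_d2 N (fundamental_form g A) (descend X) (descend Y) (descend Z) (\<pi> p) =
        wedge12 \<theta> (fundamental_form g A) (\<pi> p) (descend X (\<pi> p)) (descend Y (\<pi> p)) (descend Z (\<pi> p))"
      using descend_vector_field[OF X] descend_vector_field[OF Y] descend_vector_field[OF Z]
        proj_in_topspace[OF p] unfolding ext_d2_equals_def by blast
    \<comment> \<open>By \<open>omega\<close> the functions being differentiated are constant on the
      quotient, so the Koszul formula reduces to \<open>d_omega\<close>.\<close>
    moreover have "descend U (\<pi> p) (\<lambda>q. fundamental_form g A q (descend V q) (descend W q)) = 0"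
      if "U \<in> lie_algebra G M" "V \<in> lie_algebra G M" "W \<in> lie_algebra G M" for U V W
      by (rule descend_const[OF that(1) p]) (rule omega[OF A(1) that(2,3)])
    ultimately show "alg.d_omega A' X Y Z = t p X * ip (A' Y) Z - t p Y * ip (A' X) Z + t p Z * ip (A' X) Y"
      using X Y Z p A
      by (simp add: ext_d2_def wedge12_def alg.d_omega_def descend_bracket omega lie_algebra_bracket t_def)
  qed
  have t_const: "t p X = t \<one> X" if X: "X \<in> lie_algebra G M" and p: "p \<in> carrier G" for p X
  proof (cases "X = (\<lambda>_ _. 0)")
    case True
    have "t p (\<lambda>_ _. 0) = 0" if "p \<in> carrier G" for p
      using t_lc[OF X X that, of 0 0] by (simp add: lincomb_def)
    then show ?thesis using True p by simp
  next
    case False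
    \<comment> \<open>The right-hand side of \<open>lee_formula\<close> contains neither
      \<open>t\<close> nor \<open>p\<close>. Cancelling \<open>ip X X\<close> is what singles out
      the zero field.\<close>
    have "t p X * ip X X = t \<one> X * ip X X"
      using alg.lee_formula[OF t_lee[OF p] X] alg.lee_formula[OF t_lee[OF one_closed] X] by simp
    then show ?thesis using ip_pos[OF X False] by simp
  qed
  \<comment> \<open>On descended fields theta(X) and theta(Y) are now constant, so d theta = 0
    leaves only theta([X, Y]).\<close>
  have t_br: "t \<one> (bracket M X Y) = 0" if X: "X \<in> lie_algebra G M" and Y: "Y \<in> lie_algebra G M" for X Y
  proof -
    have "descend U base (\<lambda>q. \<theta> q (descend V q)) = 0"
      if "U \<in> lie_algebra G M" "V \<in> lie_algebra G M" for U V
      by (rule descend_const[OF that(1) one_closed]) (rule t_const[OF that(2), unfolded t_def])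
    then show ?thesis
      using closed[OF descend_vector_field[OF X] descend_vector_field[OF Y] base] X Y
      by (simp add: ext_d1_def descend_bracket t_def)
  qed
  \<comment> \<open>\<open>X0\<close> is scaled so that \<open>t\<close> becomes 1; the second
    coefficient is 0 because scaling is expressed by \<open>lincomb\<close>.\<close>
  define T where "T = ?lc (1 / t \<one> X0) X0 0 X0"
  have "t \<one> X0 \<noteq> 0"
    using t_const[OF X0(1,2)] X0(3) by (simp add: t_def)
  then have T: "T \<in> lie_algebra G M" "t \<one> T = 1"
    using lie_algebra_lincomb[OF X0(1,1)] t_lc[OF X0(1,1) one_closed] by (auto simp: T_def)
  have "t \<one> (\<lambda>_ _. 0) = 0"
    using t_lc[OF T(1,1) one_closed, of 0 0] by (simp add: lincomb_def)
  then have T0: "T \<noteq> (\<lambda>_ _. 0)" using T by auto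
  obtain m Z where Z: "Z \<in> lower_central G M m" "Z \<noteq> (\<lambda>_ _. 0)"
    and central: "\<And>Y W. Y \<in> lie_algebra G M \<Longrightarrow> W \<in> lower_central G M m \<Longrightarrow> bracket M Y W = (\<lambda>_ _. 0)"
    using nilpotent_central[OF nil T(1) T0] by metis
  show False
  proof (cases m)
    case 0
    have "alg.d_omega (L I) T (L J T) (L K T) = 0"
      using central T(1) L_in 0 alg.str_zero[of "L I"] by (simp add: alg.d_omega_def)
    then show False
      using alg.lee_formula[OF t_lee[OF one_closed] T(1)] T(2) ip_pos[OF T(1) T0] by simp
  next
    \<comment> \<open>Now \<open>Z\<close> is a combination of brackets; closedness of the Lee form,
      through \<open>t_br\<close>, places it in the kernel of \<open>t\<close>.\<close>
    case (Suc l)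
    have "Z \<in> lie_algebra G M \<and> t \<one> Z = 0"
    proof (rule field_span_induct)
      show "Z \<in> field_span {bracket M X Y | X Y. X \<in> lie_algebra G M \<and> Y \<in> lower_central G M l}"
        using Z(1) Suc by simp
      show "{bracket M X Y | X Y. X \<in> lie_algebra G M \<and> Y \<in> lower_central G M l} \<subseteq> lie_algebra G M"
        using lower_central_subset lie_algebra_bracket by blast
      show "t \<one> (\<lambda>_ _. 0) = 0" by fact
      fix c X Y
      assume "X \<in> {bracket M X Y | X Y. X \<in> lie_algebra G M \<and> Y \<in> lower_central G M l}"
        and Y: "Y \<in> lie_algebra G M" "t \<one> Y = 0"
      then have "X \<in> lie_algebra G M" "t \<one> X = 0"
        using lower_central_subset lie_algebra_bracket t_br by blast+
      then show "t \<one> (\<lambda>p. lincomb c (X p) 1 (Y p)) = 0"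
        using t_lc[OF _ Y(1) one_closed] Y(2) by simp
    qed
    then have Zg: "Z \<in> lie_algebra G M" and tZ: "t \<one> Z = 0" by auto
    have "Z = (\<lambda>_ _. 0)"
    proof (rule alg.no_central_in_kernel[where t = "t \<one>" and T = T])
      show "alg.lee (t \<one>)" by (rule t_lee[OF one_closed])
      show "t \<one> (?lc a X b Y) = a * t \<one> X + b * t \<one> Y"
        if "X \<in> lie_algebra G M" "Y \<in> lie_algebra G M" for a b X Y
        by (rule t_lc[OF that one_closed])
      show "bracket M X Z = (\<lambda>_ _. 0)" if "X \<in> lie_algebra G M" for X
        by (rule central[OF that Z(1)])
      show "\<exists>n. (bracket M T ^^ n) Y = (\<lambda>_ _. 0)" if "Y \<in> lie_algebra G M" for Y
        using bracket_iterate[OF nil T(1) that] by (rule exI)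
    qed (fact T Zg tZ t_br)+
    with Z(2) show False by contradiction
  qed
qed

end

theorem corollary4p18:
  fixes G :: "('a, 'm) monoid_scheme"
    and M :: "('a, 'e::euclidean_space) manifold"
    and \<Gamma> :: "'a set"
    and g :: "'a set \<Rightarrow> 'a set tvec \<Rightarrow> 'a set tvec \<Rightarrow> real"
  assumes "compact_nilmanifold G M \<Gamma>"
    and "left_invariant_metric G M \<Gamma> g"
  shows "\<not> (\<exists>I J K.
           left_invariant_complex_structure G M \<Gamma> I \<and>
           left_invariant_complex_structure G M \<Gamma> J \<and>
           left_invariant_complex_structure G M \<Gamma> K \<and>
           strictly_lchK (quotient_manifold G M \<Gamma>) g I J K)"
proof
  assume "\<exists>I J K.
    left_invariant_complex_structure G M \<Gamma> I \<and>
    left_invariant_complex_structure G M \<Gamma> J \<and>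
    left_invariant_complex_structure G M \<Gamma> K \<and>
    strictly_lchK (quotient_manifold G M \<Gamma>) g I J K"
  then obtain I J K where str: "left_invariant_complex_structure G M \<Gamma> I"
      "left_invariant_complex_structure G M \<Gamma> J" "left_invariant_complex_structure G M \<Gamma> K"
    and lchK: "strictly_lchK (quotient_manifold G M \<Gamma>) g I J K"
    by blast
  obtain k where k: "lower_central G M k \<subseteq> {\<lambda>_ _. 0}"
    using assms(1) unfolding compact_nilmanifold_def nilpotent_lie_group_def by blast
  interpret lie_quotient G M \<Gamma>
    using assms(1)
    by (auto intro!: lie_quotient.intro lie_grp.intro lie_quotient_axioms.intro
        simp: compact_nilmanifold_def nilpotent_lie_group_def)
  obtain \<theta> where "Lee_form N g I J K \<theta>" "\<not> exact_one_form N (topspace (mtop N)) \<theta>"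
    using lchK unfolding strictly_lchK_def by blast
  moreover have "hyperhermitian N (topspace (mtop N)) g I J K"
    using lchK unfolding strictly_lchK_def lchK_def by blast
  ultimately show False
    using left_invariant_lchK_exact[OF k assms(2), of I J K \<theta>] str by blast
qed

end
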